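(* Let $\mu$ be a finitely supported probability measure on $\mathsf{Shuffler}(\mathbb{Z})=\mathrm{FSym}(\mathbb{Z})\rtimes\mathbb{Z}$ such that its projection to $\mathbb{Z}$ induces a recurrent random walk. Then the Poisson boundary of $(\mathsf{Shuffler}(\mathbb{Z}),\mu)$ is trivial.
   Context: $\mathrm{FSym}(\mathbb{Z})$ is the group (under composition) of bijections $f:\mathbb{Z}\to\mathbb{Z}$ that are the identity outside a finite set. $\mathbb{Z}$ acts on it by $(h\cdot f)(x)=h+f(x-h)$, and $\mathsf{Shuffler}(\mathbb{Z}):=\mathrm{FSym}(\mathbb{Z})\rtimes\mathbb{Z}$ with product $(f,x)(g,y)=(f\circ(x\cdot g),x+y)$. For a probability measure $\mu$ on a countable group $G$, the $\mu$-random walk is $x_n=g_1\cdots g_n$ with $g_i$ i.i.d. of law $\mu$, started at $e_G$; $\mathbb{P}$ is the law of $(x_1,x_2,\dots)$ on $G^\infty$. The random walk induced on $\mathbb{Z}$ is driven by the push-forward of $\mu$ under the projection $\mathsf{Shuffler}(\mathbb{Z})\to\mathbb{Z}$; it is recurrent if almost surely it visits $0$ infinitely often. No non-degeneracy of $\mu$ is assumed. The Poisson boundary of $(G,\mu)$ is the space of ergodic components of the shift $T(x_1,x_2,\dots)=(x_2,x_3,\dots)$ on $(G^\infty,\mathbb{P})$; it is trivial if every shift-invariant event has $\mathbb{P}$-probability $0$ or $1$. *)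

theory Defs
  imports "HOL-Probability.Probability" "HOL-Algebra.Elementary_Groups"
begin

definition FSym :: "(int \<Rightarrow> int) monoid" where
  "FSym = \<lparr>carrier = {f. bij f \<and> finite {x. f x \<noteq> x}}, monoid.mult = (\<circ>), one = id\<rparr>"

definition shift_act :: "int \<Rightarrow> (int \<Rightarrow> int) \<Rightarrow> (int \<Rightarrow> int)" where
  "shift_act h f = (\<lambda>x. h + f (x - h))"

definition Shuffler :: "((int \<Rightarrow> int) \<times> int) monoid" where
  "Shuffler = \<lparr>carrier = carrier FSym \<times> UNIV,
     monoid.mult = (\<lambda>(f, x) (g, y). (f \<otimes>\<^bsub>FSym\<^esub> shift_act x g, x + y)),
     one = (\<one>\<^bsub>FSym\<^esub>, 0)\<rparr>"

text \<open>
  Trajectories \<open>(x\<^sub>1, x\<^sub>2, \<dots>)\<close> of a random walk are functions on \<open>nat\<close>, so that the value at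
  \<open>n\<close> is the position \<open>x\<^bsub>n+1\<^esub>\<close> at time \<open>n + 1\<close>; likewise the increment \<open>g\<^bsub>n+1\<^esub>\<close> is \<open>g n\<close>.
\<close>

primrec walk :: "('a, 'b) monoid_scheme \<Rightarrow> (nat \<Rightarrow> 'a) \<Rightarrow> nat \<Rightarrow> 'a" where
  "walk G g 0 = g 0"
| "walk G g (Suc n) = walk G g n \<otimes>\<^bsub>G\<^esub> g (Suc n)"

definition path_space :: "('a, 'b) monoid_scheme \<Rightarrow> (nat \<Rightarrow> 'a) measure" where
  "path_space G = (\<Pi>\<^sub>M n\<in>UNIV. count_space (carrier G))"

text \<open>
  The law \<open>\<P>\<close> of the trajectory. The group is meant to be countable and \<open>\<mu>\<close> to be a probability
  measure on the discrete space \<open>carrier G\<close>; \<open>walk G\<close> is then measurable.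
\<close>

definition walk_law :: "('a, 'b) monoid_scheme \<Rightarrow> 'a measure \<Rightarrow> (nat \<Rightarrow> 'a) measure" where
  "walk_law G \<mu> = distr (\<Pi>\<^sub>M n\<in>UNIV. \<mu>) (path_space G) (walk G)"

definition recurrent_walk :: "('a, 'b) monoid_scheme \<Rightarrow> 'a measure \<Rightarrow> bool" where
  "recurrent_walk G \<mu> \<longleftrightarrow> (AE x in walk_law G \<mu>. infinite {n. x n = \<one>\<^bsub>G\<^esub>})"

definition path_shift :: "(nat \<Rightarrow> 'a) \<Rightarrow> (nat \<Rightarrow> 'a)" where
  "path_shift x = (\<lambda>n. x (Suc n))"

definition shift_invariant_events :: "('a, 'b) monoid_scheme \<Rightarrow> (nat \<Rightarrow> 'a) set set" where
  "shift_invariant_events G =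
     {A \<in> sets (path_space G). path_shift -` A \<inter> space (path_space G) = A}"

definition trivial_Poisson_boundary :: "('a, 'b) monoid_scheme \<Rightarrow> 'a measure \<Rightarrow> bool" where
  "trivial_Poisson_boundary G \<mu> \<longleftrightarrow>
     (\<forall>A \<in> shift_invariant_events G. measure (walk_law G \<mu>) A \<in> {0, 1})"

lemma FSym_shift_act:
  assumes "f \<in> carrier FSym"
  shows "shift_act h f \<in> carrier FSym"
proof -
  have f: "bij f" "finite {x. f x \<noteq> x}"
    using assms by (auto simp: FSym_def)
  have "shift_act h f = (\<lambda>x. h + x) \<circ> f \<circ> (\<lambda>x. x - h)"
    by (auto simp: shift_act_def)
  moreover have "bij (\<lambda>x::int. h + x)"
    by (rule o_bij[of "\<lambda>x. x - h"]) auto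
  moreover have "bij (\<lambda>x::int. x - h)"
    by (rule o_bij[of "\<lambda>x. x + h"]) auto
  ultimately have "bij (shift_act h f)"
    using f(1) by (simp add: bij_comp)
  moreover have "{x. shift_act h f x \<noteq> x} \<subseteq> (\<lambda>x. x + h) ` {x. f x \<noteq> x}"
  proof
    fix x assume "x \<in> {x. shift_act h f x \<noteq> x}"
    then have "f (x - h) \<noteq> x - h"
      by (auto simp: shift_act_def)
    then show "x \<in> (\<lambda>x. x + h) ` {x. f x \<noteq> x}"
      by (intro image_eqI[of _ _ "x - h"]) auto
  qed
  ultimately show ?thesis
    using f(2) by (auto simp: FSym_def intro: finite_subset)
qed

lemma group_FSym: "group FSym"
proof (rule groupI)
  fix f g assume "f \<in> carrier FSym" "g \<in> carrier FSym"
  moreover have "{x. f (g x) \<noteq> x} \<subseteq> {x. f x \<noteq> x} \<union> {x. g x \<noteq> x}"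
    by auto
  ultimately show "f \<otimes>\<^bsub>FSym\<^esub> g \<in> carrier FSym"
    by (auto simp: FSym_def bij_comp intro: finite_subset)
next
  fix f assume f: "f \<in> carrier FSym"
  then have b: "bij f"
    by (auto simp: FSym_def)
  have "{x. inv_into UNIV f x \<noteq> x} \<subseteq> {x. f x \<noteq> x}"
    using b by (auto simp: bij_is_inj dest: inv_f_f[OF bij_is_inj])
      (metis bij_inv_eq_iff)
  then have "inv_into UNIV f \<in> carrier FSym"
    using f by (auto simp: FSym_def bij_imp_bij_inv intro: finite_subset)
  moreover have "inv_into UNIV f \<otimes>\<^bsub>FSym\<^esub> f = \<one>\<^bsub>FSym\<^esub>"
    using b by (simp add: FSym_def bij_is_inj)
  ultimately show "\<exists>g\<in>carrier FSym. g \<otimes>\<^bsub>FSym\<^esub> f = \<one>\<^bsub>FSym\<^esub>"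
    by blast
qed (auto simp: FSym_def)

lemma group_Shuffler: "group Shuffler"
proof (rule groupI)
  fix a b assume "a \<in> carrier Shuffler" "b \<in> carrier Shuffler"
  then show "a \<otimes>\<^bsub>Shuffler\<^esub> b \<in> carrier Shuffler"
    using monoid.m_closed[OF group.is_monoid[OF group_FSym]] FSym_shift_act
    by (auto simp: Shuffler_def)
next
  show "\<one>\<^bsub>Shuffler\<^esub> \<in> carrier Shuffler"
    using monoid.one_closed[OF group.is_monoid[OF group_FSym]] by (auto simp: Shuffler_def)
next
  fix a b c
  show "a \<otimes>\<^bsub>Shuffler\<^esub> b \<otimes>\<^bsub>Shuffler\<^esub> c = a \<otimes>\<^bsub>Shuffler\<^esub> (b \<otimes>\<^bsub>Shuffler\<^esub> c)"
    by (cases a; cases b; cases c)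
      (auto simp: Shuffler_def FSym_def shift_act_def fun_eq_iff algebra_simps)
next
  fix a show "\<one>\<^bsub>Shuffler\<^esub> \<otimes>\<^bsub>Shuffler\<^esub> a = a"
    by (cases a) (auto simp: Shuffler_def FSym_def shift_act_def fun_eq_iff)
next
  fix a assume a: "a \<in> carrier Shuffler"
  obtain f x where fx: "a = (f, x)" by (cases a)
  then have f: "f \<in> carrier FSym"
    using a by (auto simp: Shuffler_def)
  then obtain g where g: "g \<in> carrier FSym" "g \<otimes>\<^bsub>FSym\<^esub> f = \<one>\<^bsub>FSym\<^esub>"
    using group.l_inv_ex[OF group_FSym] by blast
  then have "(shift_act (- x) g, - x) \<otimes>\<^bsub>Shuffler\<^esub> a = \<one>\<^bsub>Shuffler\<^esub>"
    by (auto simp: fx Shuffler_def FSym_def shift_act_def fun_eq_iff)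
  then show "\<exists>b\<in>carrier Shuffler. b \<otimes>\<^bsub>Shuffler\<^esub> a = \<one>\<^bsub>Shuffler\<^esub>"
    using FSym_shift_act[OF g(1)]
    by (intro bexI[of _ "(shift_act (- x) g, - x)"]) (auto simp: Shuffler_def)
qed

lemma countable_carrier_Shuffler: "countable (carrier Shuffler)"
proof -
  let ?m = "\<lambda>f::int \<Rightarrow> int. (\<lambda>x. (x, f x)) ` {x. f x \<noteq> x}"
  have "countable {A :: (int \<times> int) set. finite A}"
    by (rule countable_Collect_finite)
  moreover have "?m ` carrier FSym \<subseteq> {A. finite A}"
    by (auto simp: FSym_def)
  ultimately have "countable (?m ` carrier FSym)"
    by (rule countable_subset[rotated])
  moreover have "inj_on ?m (carrier FSym)"
  proof (rule inj_onI, rule ext)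
    fix f g x assume eq: "?m f = ?m g"
    have "(x, y) \<in> ?m h \<longleftrightarrow> y = h x \<and> h x \<noteq> x" for y h
      by auto
    with eq show "f x = g x"
      by metis
  qed
  ultimately have "countable (carrier FSym)"
    by (rule countable_image_inj_on)
  then show ?thesis
    by (simp add: Shuffler_def)
qed

lemma measurable_walk:
  assumes "group G" "countable (carrier G)" "sets \<mu> = Pow (carrier G)"
  shows "walk G \<in> measurable (\<Pi>\<^sub>M n\<in>UNIV. \<mu>) (path_space G)"
proof -
  interpret group G by fact
  have sp: "space \<mu> = carrier G"
    using sets_eq_imp_space_eq[of \<mu> "count_space (carrier G)"] assms(3) by simp
  have "measurable N \<mu> = measurable N (count_space (carrier G))" for N :: "(nat \<Rightarrow> 'a) measure"
    using assms(3) by (intro measurable_cong_sets) auto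
  then have comp: "(\<lambda>g. g n) \<in> measurable (\<Pi>\<^sub>M n\<in>UNIV. \<mu>) (count_space (carrier G))" for n :: nat
    using measurable_component_singleton[of n UNIV "\<lambda>_. \<mu>"] by simp
  have *: "(\<lambda>g. walk G g n) \<in> measurable (\<Pi>\<^sub>M n\<in>UNIV. \<mu>) (count_space (carrier G))" for n
  proof (induction n)
    case (Suc n)
    have "(\<lambda>g. a \<otimes>\<^bsub>G\<^esub> g (Suc n)) \<in> measurable (\<Pi>\<^sub>M n\<in>UNIV. \<mu>) (count_space (carrier G))"
      if "a \<in> carrier G" for a
      using measurable_compose[OF comp[of "Suc n"],
          of "\<lambda>b. a \<otimes>\<^bsub>G\<^esub> b" "count_space (carrier G)"] that by auto
    from measurable_compose_countable'[OF this Suc assms(2)] show ?case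
      by simp
  qed (simp add: comp)
  show ?thesis
    unfolding path_space_def
    using measurable_PiM_single'[of UNIV "\<lambda>n g. walk G g n", OF *] *[THEN measurable_space]
    by (auto simp: PiE_def)
qed

lemma prob_space_walk_law:
  assumes "group G" "countable (carrier G)" "prob_space \<mu>" "sets \<mu> = Pow (carrier G)"
  shows "prob_space (walk_law G \<mu>)"
  unfolding walk_law_def
  using assms by (intro prob_space.prob_space_distr prob_space_PiM measurable_walk)

end

theory Submission
  imports Defs "HOL-Real_Asymp.Real_Asymp"
begin

text \<open>
  A recurrent walk with bounded steps on the integers is centred, so it explores an interval of
  length \<open>n\<^sup>c\<close> with \<open>c < 1\<close> up to time \<open>n\<close>, and the permutation at time \<open>n\<close> is supported near that
  interval. There are \<open>exp (o(n))\<close> such permutations, hence the entropy of the walk grows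
  sublinearly. Now let \<open>f\<close> be a bounded harmonic function and let the first step have law \<open>\<mu>\<close>. The
  increment \<open>H(\<mu>\<^bsup>n+1\<^esup>) - H(\<mu>\<^bsup>n\<^esup>)\<close> of the entropies of convolution powers is the mean relative
  entropy of the translates \<open>g\<mu>\<^bsup>n\<^esup>\<close> with respect to their mixture \<open>\<mu>\<^bsup>n+1\<^esup>\<close>; by a
  Pinsker-type inequality it controls \<open>f g - f 1\<close> on the support of \<open>\<mu>\<close>. The increments are
  arbitrarily small, so \<open>f\<close> does not change along the walk. Applied to the probability that a
  shift-invariant event occurs for the walk started at \<open>x\<close>, this makes the event independent of all
  increments, hence of itself.
\<close>

section \<open>Entropy of finitely supported laws\<close>

text \<open>The Hellinger distance \<open>(\<surd>p - \<surd>q)\<^sup>2\<close> sits between the two sides: it is bounded by the relative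
  entropy because \<open>ln x \<le> x - 1\<close>, and it controls \<open>\<bar>p - q\<bar>\<close> by AM-GM. Being pointwise, the inequality
  sums to a bound on total variation without Cauchy-Schwarz.\<close>

lemma abs_diff_le_relative_entropy:
  fixes p q t :: real
  assumes "p \<ge> 0" "q \<ge> 0" "q = 0 \<Longrightarrow> p = 0" "t > 0"
  shows "\<bar>p - q\<bar> \<le> (p * ln p - p * ln q - p + q) / (2 * t) + t * (p + q)"
proof -
  define u v where "u = sqrt p" and "v = sqrt q"
  have uv: "u \<ge> 0" "v \<ge> 0" "p = u\<^sup>2" "q = v\<^sup>2"
    using assms by (auto simp: u_def v_def)
  have hellinger: "(u - v)\<^sup>2 \<le> p * ln p - p * ln q - p + q"
  proof (cases "u = 0")
    case False
    then have pos: "u > 0" "v > 0"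
      using assms(3) uv by (auto simp: less_le)
    have "ln (v / u) \<le> v / u - 1"
      using pos by (intro ln_le_minus_one) auto
    then have "u\<^sup>2 * (ln v - ln u) \<le> u\<^sup>2 * (v / u - 1)"
      using pos by (intro mult_left_mono) (auto simp: ln_div)
    also have "\<dots> = u * v - u\<^sup>2"
      using pos by (simp add: field_simps power2_eq_square)
    finally show ?thesis
      using pos by (simp add: uv ln_mult power2_eq_square algebra_simps)
  qed (simp add: uv)
  have "\<bar>p - q\<bar> = \<bar>u - v\<bar> * (u + v)"
    using uv by (simp add: power2_eq_square square_diff_square_factored abs_mult mult.commute)
  also have "\<dots> \<le> (u - v)\<^sup>2 / (2 * t) + t / 2 * (u + v)\<^sup>2"
  proof -
    have "0 \<le> (\<bar>u - v\<bar> - t * (u + v))\<^sup>2"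
      by simp
    also have "\<dots> = (u - v)\<^sup>2 - 2 * t * (\<bar>u - v\<bar> * (u + v)) + t\<^sup>2 * (u + v)\<^sup>2"
      by (simp add: power2_diff power_mult_distrib)
    finally show ?thesis
      using assms(4) by (simp add: field_simps power2_eq_square)
  qed
  also have "\<dots> \<le> (p * ln p - p * ln q - p + q) / (2 * t) + t * (p + q)"
  proof (rule add_mono)
    have "t * (u + v)\<^sup>2 \<le> t * (2 * (u\<^sup>2 + v\<^sup>2))"
      using sum_squares_bound[of u v] assms(4) by (intro mult_left_mono) (auto simp: power2_sum)
    then show "t / 2 * (u + v)\<^sup>2 \<le> t * (p + q)"
      by (simp add: uv algebra_simps)
  qed (use hellinger assms(4) in \<open>auto intro: divide_right_mono\<close>)
  finally show ?thesis .
qed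

text \<open>For a law with infinite support the sum, and with it the entropy, is the junk value 0.\<close>

definition entropy_pmf :: "'a pmf \<Rightarrow> real" where
  "entropy_pmf p = - (\<Sum>x\<in>set_pmf p. pmf p x * ln (pmf p x))"

lemma entropy_pmf_superset:
  assumes "finite S" "set_pmf p \<subseteq> S"
  shows "entropy_pmf p = - (\<Sum>x\<in>S. pmf p x * ln (pmf p x))"
  unfolding entropy_pmf_def
  using assms by (auto intro!: sum.mono_neutral_left simp: pmf_eq_0_set_pmf)

lemma entropy_pmf_map_inj:
  assumes "inj_on f (set_pmf p)"
  shows "entropy_pmf (map_pmf f p) = entropy_pmf p"
  using assms by (simp add: entropy_pmf_def sum.reindex pmf_map_inj)

lemma entropy_pmf_return [simp]: "entropy_pmf (return_pmf x) = 0"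
  by (simp add: entropy_pmf_def)

lemma expectation_superset:
  fixes f :: "'a \<Rightarrow> real"
  assumes "finite S" "set_pmf p \<subseteq> S"
  shows "measure_pmf.expectation p f = (\<Sum>x\<in>S. pmf p x * f x)"
  using assms by (subst integral_measure_pmf[of S]) auto

lemma expectation_bind_finite:
  fixes h :: "'b \<Rightarrow> real"
  assumes "finite (set_pmf p)" "\<And>a. a \<in> set_pmf p \<Longrightarrow> finite (set_pmf (K a))"
  shows "measure_pmf.expectation (p \<bind> K) h =
    measure_pmf.expectation p (\<lambda>a. measure_pmf.expectation (K a) h)"
  using assms pmf_expectation_bind[of "set_pmf p" K p h]
  by (simp add: expectation_superset[of "set_pmf p" p])

lemma expectation_mono_finite:
  fixes f g :: "'a \<Rightarrow> real"
  assumes "finite (set_pmf p)" "\<And>a. a \<in> set_pmf p \<Longrightarrow> f a \<le> g a"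
  shows "measure_pmf.expectation p f \<le> measure_pmf.expectation p g"
  using assms by (auto simp: expectation_superset[of "set_pmf p" p] intro!: sum_mono mult_left_mono)

text \<open>Gibbs' inequality: sum \<open>ln x <= x - 1\<close> at \<open>x = w / p\<close> against
  \<open>p\<close>. A bound on the entropy thus only takes an explicit subprobability weight
  \<open>w\<close>, which is how counting points turns into an entropy estimate.\<close>

lemma entropy_pmf_le_cross_entropy:
  assumes fin: "finite (set_pmf p)" and pos: "\<And>x. x \<in> set_pmf p \<Longrightarrow> w x > 0"
    and w: "(\<Sum>x\<in>set_pmf p. w x) \<le> 1"
  shows "entropy_pmf p \<le> measure_pmf.expectation p (\<lambda>x. - ln (w x))"
proof -
  have "pmf p x * ln (w x) - pmf p x * ln (pmf p x) \<le> w x - pmf p x" if x: "x \<in> set_pmf p" for x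
  proof -
    have p: "pmf p x > 0"
      using x by (simp add: pmf_positive)
    have "ln (w x / pmf p x) \<le> w x / pmf p x - 1"
      using p pos[OF x] by (intro ln_le_minus_one) auto
    then have "pmf p x * (ln (w x) - ln (pmf p x)) \<le> pmf p x * (w x / pmf p x - 1)"
      using p pos[OF x] by (intro mult_left_mono) (auto simp: ln_div)
    then show ?thesis
      using p by (simp add: algebra_simps)
  qed
  then have "(\<Sum>x\<in>set_pmf p. pmf p x * ln (w x) - pmf p x * ln (pmf p x))
      \<le> (\<Sum>x\<in>set_pmf p. w x - pmf p x)"
    by (rule sum_mono)
  also have "\<dots> \<le> 0"
    using w sum_pmf_eq_1[OF fin order_refl] by (simp add: sum_subtractf)
  finally show ?thesis
    using fin by (simp add: entropy_pmf_def expectation_superset[OF fin order_refl] sum_subtractf sum_negf)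
qed

text \<open>The entropy of a mixture minus the mean entropy of its components is the mean relative
  entropy of the components with respect to the mixture. The pointwise inequality
  \<open>abs_diff_le_relative_entropy\<close> converts this into total variation, and the bound
  \<open>M\<close> into differences of means of \<open>f\<close>. The parameter \<open>t\<close>
  stays free in place of the square root in Pinsker's inequality.\<close>

lemma entropy_pmf_mixture:
  fixes f :: "'b \<Rightarrow> real"
  assumes fin: "finite (set_pmf p)" "\<And>a. a \<in> set_pmf p \<Longrightarrow> finite (set_pmf (K a))"
    and f: "\<And>y. y \<in> set_pmf (p \<bind> K) \<Longrightarrow> \<bar>f y\<bar> \<le> M" and "M \<ge> 0" "t > 0"
  shows "measure_pmf.expectation p
      (\<lambda>a. \<bar>measure_pmf.expectation (K a) f - measure_pmf.expectation (p \<bind> K) f\<bar>)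
    \<le> M * ((entropy_pmf (p \<bind> K) - measure_pmf.expectation p (\<lambda>a. entropy_pmf (K a))) / (2 * t) + 2 * t)"
proof -
  define r where "r = p \<bind> K"
  define A where "A = set_pmf p"
  define S where "S = set_pmf r"
  have finA: "finite A" and finS: "finite S" and sub: "\<And>a. a \<in> A \<Longrightarrow> set_pmf (K a) \<subseteq> S"
    using fin by (auto simp: A_def S_def r_def)
  note E = expectation_superset[of A p, OF finA] expectation_superset[OF finS sub]
    expectation_superset[of S r, OF finS]
  have r: "pmf r y = (\<Sum>a\<in>A. pmf p a * pmf (K a) y)" for y
    unfolding r_def pmf_bind by (rule E) (simp add: A_def)
  have sum1: "(\<Sum>y\<in>S. pmf r y) = 1" "(\<Sum>a\<in>A. pmf p a) = 1" "\<And>a. a \<in> A \<Longrightarrow> (\<Sum>y\<in>S. pmf (K a) y) = 1"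
    using finS finA sub by (auto intro!: sum_pmf_eq_1 simp: A_def S_def)
  let ?d = "\<lambda>a y. (pmf (K a) y * ln (pmf (K a) y) - pmf (K a) y * ln (pmf r y)
            - pmf (K a) y + pmf r y) / (2 * t) + t * (pmf (K a) y + pmf r y)"
  have *: "\<bar>measure_pmf.expectation (K a) f - measure_pmf.expectation r f\<bar>
      \<le> M * ((- entropy_pmf (K a) - (\<Sum>y\<in>S. pmf (K a) y * ln (pmf r y))) / (2 * t) + 2 * t)"
    if a: "a \<in> A" for a
  proof -
    have "\<bar>measure_pmf.expectation (K a) f - measure_pmf.expectation r f\<bar>
        = \<bar>\<Sum>y\<in>S. (pmf (K a) y - pmf r y) * f y\<bar>"
      using a by (simp add: E S_def sum_subtractf algebra_simps)
    also have "\<dots> \<le> (\<Sum>y\<in>S. \<bar>pmf (K a) y - pmf r y\<bar> * \<bar>f y\<bar>)"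
      by (rule order_trans[OF sum_abs]) (simp add: abs_mult)
    also have "\<dots> \<le> (\<Sum>y\<in>S. ?d a y * M)"
    proof (intro sum_mono mult_mono)
      fix y assume y: "y \<in> S"
      show "\<bar>pmf (K a) y - pmf r y\<bar> \<le> ?d a y"
        using y \<open>t > 0\<close> by (intro abs_diff_le_relative_entropy) (auto simp: S_def pmf_eq_0_set_pmf)
      then show "0 \<le> ?d a y"
        by linarith
      show "\<bar>f y\<bar> \<le> M"
        using f y by (simp add: S_def r_def)
    qed simp
    also have "\<dots> = M * (\<Sum>y\<in>S. ?d a y)"
      by (simp add: sum_distrib_left mult.commute)
    \<comment> \<open>Both laws have total mass 1, so the linear terms \<open>- p + q\<close> cancel
      and \<open>t * (p + q)\<close> sums to \<open>2 * t\<close>.\<close>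
    also have "(\<Sum>y\<in>S. ?d a y) =
        ((\<Sum>y\<in>S. pmf (K a) y * ln (pmf (K a) y)) - (\<Sum>y\<in>S. pmf (K a) y * ln (pmf r y))) / (2 * t) + 2 * t"
      using sum1 a by (simp add: sum.distrib sum_subtractf flip: sum_divide_distrib sum_distrib_left)
    finally show ?thesis
      using a by (simp add: entropy_pmf_superset[OF finS sub])
  qed
  have "measure_pmf.expectation p
      (\<lambda>a. \<bar>measure_pmf.expectation (K a) f - measure_pmf.expectation r f\<bar>)
    \<le> (\<Sum>a\<in>A. pmf p a * (M * ((- entropy_pmf (K a) - (\<Sum>y\<in>S. pmf (K a) y * ln (pmf r y))) / (2 * t) + 2 * t)))"
    using * by (subst E) (auto intro!: sum_mono mult_left_mono simp: A_def)
  also have "\<dots> = M * ((- (\<Sum>a\<in>A. pmf p a * entropy_pmf (K a)) -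
      (\<Sum>a\<in>A. pmf p a * (\<Sum>y\<in>S. pmf (K a) y * ln (pmf r y)))) / (2 * t) + (\<Sum>a\<in>A. pmf p a) * (2 * t))"
    by (simp add: sum_distrib_left sum_distrib_right sum_divide_distrib sum_subtractf sum_negf sum.distrib
        algebra_simps add_divide_distrib diff_divide_distrib)
  \<comment> \<open>The cross entropy with \<open>r\<close> is linear in its first argument, so
    averaging it over \<open>a\<close> leaves the entropy of \<open>r\<close> itself.\<close>
  also have "(\<Sum>a\<in>A. pmf p a * (\<Sum>y\<in>S. pmf (K a) y * ln (pmf r y))) = (\<Sum>y\<in>S. pmf r y * ln (pmf r y))"
    unfolding r sum_distrib_right sum_distrib_left by (subst sum.swap) (simp add: mult.assoc)
  also have "\<dots> = - entropy_pmf r"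
    by (simp add: entropy_pmf_def S_def)
  finally show ?thesis
    using sum1(2) by (simp add: E A_def r_def)
qed

section \<open>Convolution powers and harmonic functions\<close>

primrec conv_pow :: "('a, 'b) monoid_scheme \<Rightarrow> 'a pmf \<Rightarrow> nat \<Rightarrow> 'a pmf" where
  "conv_pow G p 0 = return_pmf \<one>\<^bsub>G\<^esub>"
| "conv_pow G p (Suc n) = conv_pow G p n \<bind> (\<lambda>x. map_pmf (\<lambda>a. x \<otimes>\<^bsub>G\<^esub> a) p)"

lemma finite_set_conv_pow: "finite (set_pmf p) \<Longrightarrow> finite (set_pmf (conv_pow G p n))"
  by (induction n) auto

lemma expectation_conv_pow_Suc:
  fixes h :: "'a \<Rightarrow> real"
  assumes "finite (set_pmf p)"
  shows "measure_pmf.expectation (conv_pow G p (Suc n)) h =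
    measure_pmf.expectation (conv_pow G p n) (\<lambda>x. measure_pmf.expectation p (\<lambda>a. h (x \<otimes>\<^bsub>G\<^esub> a)))"
  using assms by (simp add: expectation_bind_finite finite_set_conv_pow)

context group
begin

lemma set_conv_pow:
  assumes "set_pmf p \<subseteq> carrier G"
  shows "set_pmf (conv_pow G p n) \<subseteq> carrier G"
  using assms by (induction n) auto

text \<open>By associativity the first step can be split off instead of the last one. This exhibits
  the next convolution power as a mixture of left translates of the current one, the form to which
  \<open>entropy_pmf_mixture\<close> applies.\<close>

lemma conv_pow_Suc_left:
  assumes p: "set_pmf p \<subseteq> carrier G"
  shows "conv_pow G p (Suc n) = p \<bind> (\<lambda>a. map_pmf (\<lambda>x. a \<otimes> x) (conv_pow G p n))"
proof (induction n)
  case 0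
  have "map_pmf (\<lambda>a. \<one> \<otimes> a) p = p"
    using p by (subst map_pmf_cong[OF refl, of p _ "\<lambda>x. x"]) auto
  moreover have "p \<bind> (\<lambda>a. return_pmf (a \<otimes> \<one>)) = p \<bind> return_pmf"
    using p by (intro bind_pmf_cong) auto
  ultimately show ?case
    by (simp add: bind_return_pmf bind_return_pmf')
next
  case (Suc n)
  have "conv_pow G p (Suc (Suc n)) =
      p \<bind> (\<lambda>a. map_pmf (\<lambda>x. a \<otimes> x) (conv_pow G p n)) \<bind> (\<lambda>x. map_pmf (\<lambda>b. x \<otimes> b) p)"
    by (subst conv_pow.simps) (simp only: Suc)
  also have "\<dots> = p \<bind> (\<lambda>a. conv_pow G p n \<bind> (\<lambda>x. map_pmf (\<lambda>b. a \<otimes> x \<otimes> b) p))"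
    by (simp add: bind_assoc_pmf bind_map_pmf)
  also have "\<dots> = p \<bind> (\<lambda>a. conv_pow G p n \<bind> (\<lambda>x. map_pmf (\<lambda>b. a \<otimes> (x \<otimes> b)) p))"
  proof (intro bind_pmf_cong map_pmf_cong refl)
    fix a x b assume "a \<in> set_pmf p" "x \<in> set_pmf (conv_pow G p n)" "b \<in> set_pmf p"
    then show "a \<otimes> x \<otimes> b = a \<otimes> (x \<otimes> b)"
      using p set_conv_pow[OF p, of n] by (auto intro!: m_assoc)
  qed
  finally show ?case
    by (simp add: map_bind_pmf pmf.map_comp o_def)
qed

lemma harmonic_expectation_conv_pow:
  fixes f :: "'a \<Rightarrow> real"
  assumes p: "finite (set_pmf p)" "set_pmf p \<subseteq> carrier G"
    and f: "\<And>x. x \<in> carrier G \<Longrightarrow> measure_pmf.expectation p (\<lambda>a. f (x \<otimes> a)) = f x"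
    and x: "x \<in> carrier G"
  shows "measure_pmf.expectation (conv_pow G p n) (\<lambda>y. f (x \<otimes> y)) = f x"
proof (induction n)
  case (Suc n)
  note fin = finite_set_conv_pow[OF p(1), of G n]
  have "measure_pmf.expectation (conv_pow G p (Suc n)) (\<lambda>y. f (x \<otimes> y)) =
      measure_pmf.expectation (conv_pow G p n) (\<lambda>y. measure_pmf.expectation p (\<lambda>a. f (x \<otimes> (y \<otimes> a))))"
    by (rule expectation_conv_pow_Suc[OF p(1)])
  also have "\<dots> = measure_pmf.expectation (conv_pow G p n) (\<lambda>y. measure_pmf.expectation p (\<lambda>a. f (x \<otimes> y \<otimes> a)))"
    using p(2) set_conv_pow[OF p(2), of n] x
    by (auto simp: expectation_superset[OF fin order_refl] expectation_superset[OF p(1) order_refl] subset_iff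
        m_assoc intro!: sum.cong)
  also have "\<dots> = measure_pmf.expectation (conv_pow G p n) (\<lambda>y. f (x \<otimes> y))"
    using set_conv_pow[OF p(2), of n] x
    by (auto simp: expectation_superset[OF fin order_refl] f subset_iff intro!: sum.cong)
  finally show ?case
    using Suc by simp
qed (use x in simp)

text \<open>Left translations are injective, so every component of the mixture has the entropy of
  \<open>conv_pow G p n\<close>, and the entropy gap becomes an increment. Harmonicity evaluates the
  mean of \<open>f\<close> over the translate by \<open>a\<close> as \<open>f a\<close> and over the
  mixture as \<open>f \<one>\<close>.\<close>

lemma harmonic_deviation_le_entropy_increment:
  fixes f :: "'a \<Rightarrow> real"
  assumes p: "finite (set_pmf p)" "set_pmf p \<subseteq> carrier G"
    and f: "\<And>x. x \<in> carrier G \<Longrightarrow> measure_pmf.expectation p (\<lambda>a. f (x \<otimes> a)) = f x"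
    and M: "\<And>x. x \<in> carrier G \<Longrightarrow> \<bar>f x\<bar> \<le> M" "M \<ge> 0" and "t > 0"
  shows "measure_pmf.expectation p (\<lambda>a. \<bar>f a - f \<one>\<bar>) \<le>
    M * ((entropy_pmf (conv_pow G p (Suc n)) - entropy_pmf (conv_pow G p n)) / (2 * t) + 2 * t)"
proof -
  define K where "K = (\<lambda>a. map_pmf (\<lambda>x. a \<otimes> x) (conv_pow G p n))"
  have K: "conv_pow G p (Suc n) = p \<bind> K"
    unfolding K_def by (rule conv_pow_Suc_left[OF p(2)])
  have 1: "entropy_pmf (K a) = entropy_pmf (conv_pow G p n)"
    "measure_pmf.expectation (K a) f = f a"
    if "a \<in> set_pmf p" for a
  proof -
    have a: "a \<in> carrier G"
      using that p by auto
    show "entropy_pmf (K a) = entropy_pmf (conv_pow G p n)"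
      unfolding K_def using a set_conv_pow[OF p(2), of n]
      by (intro entropy_pmf_map_inj) (auto simp: inj_on_def subset_iff)
    show "measure_pmf.expectation (K a) f = f a"
      unfolding K_def integral_map_pmf by (rule harmonic_expectation_conv_pow[OF p f a])
  qed
  have "measure_pmf.expectation (conv_pow G p (Suc n)) (\<lambda>y. f (\<one> \<otimes> y)) = f \<one>"
    by (rule harmonic_expectation_conv_pow[OF p]) (auto intro: f)
  then have 2: "measure_pmf.expectation (conv_pow G p (Suc n)) f = f \<one>"
    using set_conv_pow[OF p(2), of "Suc n"]
    by (subst (asm) integral_cong_AE[of _ _ f]) (auto simp: AE_measure_pmf_iff subset_iff simp del: conv_pow.simps)
  have "measure_pmf.expectation p
      (\<lambda>a. \<bar>measure_pmf.expectation (K a) f - measure_pmf.expectation (p \<bind> K) f\<bar>)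
    \<le> M * ((entropy_pmf (p \<bind> K) - measure_pmf.expectation p (\<lambda>a. entropy_pmf (K a))) / (2 * t) + 2 * t)"
  proof (rule entropy_pmf_mixture)
    show "\<And>a. a \<in> set_pmf p \<Longrightarrow> finite (set_pmf (K a))"
      by (simp add: K_def finite_set_conv_pow p)
    show "\<bar>f y\<bar> \<le> M" if "y \<in> set_pmf (p \<bind> K)" for y
      using M(1) set_conv_pow[OF p(2), of "Suc n"] that unfolding K by auto
  qed (use p M \<open>t > 0\<close> in auto)
  moreover have "measure_pmf.expectation p (\<lambda>a. entropy_pmf (K a)) = entropy_pmf (conv_pow G p n)"
    using sum_pmf_eq_1[OF p(1) order_refl]
    by (simp add: expectation_superset[OF p(1) order_refl] 1 flip: sum_distrib_right)
  moreover have "measure_pmf.expectation p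
      (\<lambda>a. \<bar>measure_pmf.expectation (K a) f - measure_pmf.expectation (p \<bind> K) f\<bar>) =
      measure_pmf.expectation p (\<lambda>a. \<bar>f a - f \<one>\<bar>)"
    by (simp add: expectation_superset[OF p(1) order_refl] 1 2[unfolded K])
  ultimately show ?thesis
    by (simp only: K)
qed

text \<open>Left translates of harmonic functions are harmonic, which reduces the claim to the point
  \<open>\<one>\<close>. The mean deviation there does not depend on \<open>n\<close>, whereas its
  bounds telescope when summed over \<open>n < N\<close>; one good \<open>N\<close> for each
  \<open>e\<close> is therefore enough.\<close>

lemma harmonic_const_of_sublinear_entropy:
  fixes f :: "'a \<Rightarrow> real"
  assumes p: "finite (set_pmf p)" "set_pmf p \<subseteq> carrier G"
    and f: "\<And>x. x \<in> carrier G \<Longrightarrow> measure_pmf.expectation p (\<lambda>a. f (x \<otimes> a)) = f x"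
    and M: "\<And>x. x \<in> carrier G \<Longrightarrow> \<bar>f x\<bar> \<le> M"
    and H: "\<And>e. e > 0 \<Longrightarrow> \<exists>N>0. entropy_pmf (conv_pow G p N) \<le> e * real N"
    and x: "x \<in> carrier G" and a: "a \<in> set_pmf p"
  shows "f (x \<otimes> a) = f x"
proof -
  have M0: "M \<ge> 0"
    using M[OF one_closed] by linarith
  define g where "g y = f (x \<otimes> y)" for y
  have g: "measure_pmf.expectation p (\<lambda>b. g (y \<otimes> b)) = g y" if y: "y \<in> carrier G" for y
  proof -
    have "measure_pmf.expectation p (\<lambda>b. g (y \<otimes> b)) = measure_pmf.expectation p (\<lambda>b. f (x \<otimes> y \<otimes> b))"
      using p(2) x y unfolding g_def
      by (auto simp: expectation_superset[OF p(1) order_refl] m_assoc subset_iff intro!: sum.cong)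
    then show ?thesis
      using f[of "x \<otimes> y"] x y by (simp add: g_def)
  qed
  have gM: "\<bar>g y\<bar> \<le> M" if "y \<in> carrier G" for y
    using M x that by (simp add: g_def)
  define D where "D = measure_pmf.expectation p (\<lambda>b. \<bar>g b - g \<one>\<bar>)"
  have D_le: "D \<le> M * (t / 2 + 2 * t)" if t: "t > 0" for t
  proof -
    \<comment> \<open>With \<open>e = t\<^sup>2\<close> both terms of the bound, entropy over
      \<open>2 * t\<close> and \<open>2 * t\<close>, are of order \<open>t\<close> per step.\<close>
    obtain N where N: "N > 0" "entropy_pmf (conv_pow G p N) \<le> t\<^sup>2 * real N"
      using H[of "t\<^sup>2"] t by auto
    have "real N * D = (\<Sum>n<N. D)"
      by simp
    also have "\<dots> \<le> (\<Sum>n<N. M * ((entropy_pmf (conv_pow G p (Suc n)) - entropy_pmf (conv_pow G p n)) / (2 * t) + 2 * t))"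
      unfolding D_def by (intro sum_mono harmonic_deviation_le_entropy_increment[OF p g gM M0 t])
    also have "\<dots> = M * (entropy_pmf (conv_pow G p N) / (2 * t) + real N * (2 * t))"
      using sum_lessThan_telescope[of "\<lambda>n. entropy_pmf (conv_pow G p n)" N]
      by (simp add: sum.distrib flip: sum_distrib_left sum_divide_distrib)
    also have "\<dots> \<le> M * (t\<^sup>2 * real N / (2 * t) + real N * (2 * t))"
      using N t M0 by (intro mult_left_mono add_mono divide_right_mono) auto
    also have "\<dots> = real N * (M * (t / 2 + 2 * t))"
      using t by (simp add: field_simps power2_eq_square)
    finally show ?thesis
      using N(1) by simp
  qed
  have "D \<le> 0"
  proof (rule ccontr)
    assume "\<not> D \<le> 0"
    then have D: "D > 0" by simp
    \<comment> \<open>Chosen so that the bound becomes at most \<open>D / 2\<close>;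
      \<open>M + 1\<close> avoids a division by zero when \<open>M = 0\<close>.\<close>
    define t where "t = D / (5 * (M + 1))"
    have "t > 0"
      using D M0 by (simp add: t_def)
    then have "D \<le> M * (t / 2 + 2 * t)"
      by (rule D_le)
    also have "\<dots> \<le> (M + 1) * (5 * t) / 2"
      using \<open>t > 0\<close> by (simp add: field_simps)
    also have "\<dots> = D / 2"
      using M0 by (simp add: t_def field_simps)
    finally show False
      using D by simp
  qed
  then have "(\<Sum>b\<in>set_pmf p. pmf p b * \<bar>g b - g \<one>\<bar>) \<le> 0"
    by (simp add: D_def expectation_superset[OF p(1) order_refl])
  then have "(\<Sum>b\<in>set_pmf p. pmf p b * \<bar>g b - g \<one>\<bar>) = 0"
    by (intro antisym sum_nonneg) auto
  then have "pmf p a * \<bar>g a - g \<one>\<bar> = 0"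
    using p(1) a by (subst (asm) sum_nonneg_eq_0_iff) auto
  then show ?thesis
    using a x by (simp add: g_def set_pmf_iff)
qed

end

section \<open>Shift-invariant events of random walks\<close>

locale countable_group_walk = group G for G (structure) +
  fixes \<mu> :: "'a measure"
  assumes countable_carrier: "countable (carrier G)"
    and prob_step: "prob_space \<mu>"
    and sets_step: "sets \<mu> = Pow (carrier G)"
begin

abbreviation increments :: "(nat \<Rightarrow> 'a) measure" where
  "increments \<equiv> \<Pi>\<^sub>M n\<in>UNIV. \<mu>"

text \<open>The starting point \<open>x\<close> is not recorded: entry \<open>n\<close> is the
  position after \<open>n + 1\<close> steps.\<close>

definition trajectory :: "'a \<Rightarrow> (nat \<Rightarrow> 'a) \<Rightarrow> nat \<Rightarrow> 'a" where
  "trajectory x g = (\<lambda>n. x \<otimes> walk G g n)"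

lemma space_step: "space \<mu> = carrier G"
  using sets_eq_imp_space_eq[of \<mu> "count_space (carrier G)"] sets_step by simp

lemma measurable_step: "h \<in> measurable \<mu> (count_space UNIV)"
  by (simp add: measurable_def sets_step space_step)

lemma set_step_pmf:
  assumes "measure_pmf p = distr \<mu> (count_space UNIV) (\<lambda>x. x)"
  shows "set_pmf p \<subseteq> carrier G"
proof -
  have "AE x in measure_pmf p. x \<in> carrier G"
    unfolding assms using AE_space[of \<mu>] by (subst AE_distr_iff[OF measurable_step]) (auto simp: space_step)
  then show ?thesis
    by (auto simp: AE_measure_pmf_iff)
qed

lemma prob_space_increments: "prob_space increments"
  by (intro prob_space_PiM prob_step)

lemma space_increments: "g \<in> space increments \<longleftrightarrow> (\<forall>n. g n \<in> carrier G)"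
  by (auto simp: space_PiM space_step PiE_iff)

lemma space_path: "y \<in> space (path_space G) \<longleftrightarrow> (\<forall>n. y n \<in> carrier G)"
  by (auto simp: path_space_def space_PiM PiE_iff)

lemma case_nat_increments:
  "a \<in> carrier G \<Longrightarrow> g \<in> space increments \<Longrightarrow> case_nat a g \<in> space increments"
  by (auto simp: space_increments split: nat.split)

lemma walk_closed: "g \<in> space increments \<Longrightarrow> walk G g n \<in> carrier G"
  by (induction n) (auto simp: space_increments)

lemma trajectory_one: "g \<in> space increments \<Longrightarrow> trajectory \<one> g = walk G g"
  by (auto simp: trajectory_def walk_closed)

lemma walk_case_nat:
  assumes "a \<in> carrier G" "g \<in> space increments"
  shows "walk G (case_nat a g) (Suc n) = a \<otimes> walk G g n"
proof (induction n)
  case (Suc n)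
  then show ?case
    using assms walk_closed[of g n] by (simp add: space_increments m_assoc)
qed simp

text \<open>The Markov property in pathwise form: forgetting the first position amounts to starting
  afresh from it.\<close>

lemma trajectory_case_nat:
  assumes "x \<in> carrier G" "a \<in> carrier G" "g \<in> space increments"
  shows "path_shift (trajectory x (case_nat a g)) = trajectory (x \<otimes> a) g"
  using assms walk_closed[of g]
  by (auto simp: path_shift_def trajectory_def walk_case_nat m_assoc simp del: walk.simps)

lemma trajectory_in_path_space:
  "x \<in> carrier G \<Longrightarrow> g \<in> space increments \<Longrightarrow> trajectory x g \<in> space (path_space G)"
  by (simp add: space_path trajectory_def walk_closed)

lemma measurable_trajectory:
  assumes x: "x \<in> carrier G"
  shows "trajectory x \<in> measurable increments (path_space G)"
proof -
  have "(\<lambda>y n. x \<otimes> y n) \<in> measurable (path_space G) (path_space G)"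
    unfolding path_space_def
  proof (rule measurable_PiM_single')
    fix n :: nat
    have "(\<lambda>y. y n) \<in> measurable (\<Pi>\<^sub>M n\<in>UNIV. count_space (carrier G)) (count_space (carrier G))"
      by simp
    then show "(\<lambda>y. x \<otimes> y n) \<in> measurable (\<Pi>\<^sub>M n\<in>UNIV. count_space (carrier G)) (count_space (carrier G))"
      by (rule measurable_compose) (use x in auto)
  qed (use x in \<open>auto simp: space_PiM PiE_iff\<close>)
  from measurable_compose[OF measurable_walk this]
  show ?thesis
    using countable_carrier sets_step is_group by (simp add: trajectory_def[abs_def])
qed

text \<open>Fubini after splitting the sequence of increments into its head and its tail, which is
  again a sequence of i.i.d. increments.\<close>

lemma emeasure_increments_step:
  assumes D: "D \<in> sets increments"
  shows "emeasure increments D = (\<integral>\<^sup>+a. emeasure increments {g \<in> space increments. case_nat a g \<in> D} \<partial>\<mu>)"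
proof -
  interpret P: prob_space \<mu>
    by (rule prob_step)
  interpret S: sequence_space \<mu>
    by unfold_locales
  let ?f = "\<lambda>(a, g). case_nat a g"
  have f: "?f \<in> measurable (\<mu> \<Otimes>\<^sub>M increments) increments"
    by measurable
  have "emeasure increments D = emeasure (distr (\<mu> \<Otimes>\<^sub>M increments) increments ?f) D"
    by (simp only: S.PiM_iter)
  also have "\<dots> = emeasure (\<mu> \<Otimes>\<^sub>M increments) (?f -` D \<inter> space (\<mu> \<Otimes>\<^sub>M increments))"
    by (rule emeasure_distr[OF f D])
  also have "\<dots> = (\<integral>\<^sup>+a. emeasure increments (Pair a -` (?f -` D \<inter> space (\<mu> \<Otimes>\<^sub>M increments))) \<partial>\<mu>)"
    using measurable_sets[OF f D] by (rule S.P.emeasure_pair_measure_alt)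
  also have "\<dots> = (\<integral>\<^sup>+a. emeasure increments {g \<in> space increments. case_nat a g \<in> D} \<partial>\<mu>)"
    by (intro nn_integral_cong arg_cong[where f="emeasure increments"]) (auto simp: space_pair_measure)
  finally show ?thesis .
qed

section \<open>The zero-one law for shift-invariant events\<close>

definition cylinder :: "nat \<Rightarrow> (nat \<Rightarrow> 'a set) \<Rightarrow> (nat \<Rightarrow> 'a) set" where
  "cylinder n X = {g \<in> space increments. \<forall>i<n. g i \<in> X i}"

lemma cylinder_eq_prod_emb:
  assumes "\<And>i. i < n \<Longrightarrow> X i \<subseteq> carrier G"
  shows "cylinder n X = prod_emb UNIV (\<lambda>_. \<mu>) {..<n} (Pi\<^sub>E {..<n} X)"
  by (auto simp: cylinder_def prod_emb_def space_PiM PiE_iff)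

lemma sets_cylinder:
  assumes "\<And>i. i < n \<Longrightarrow> X i \<subseteq> carrier G"
  shows "cylinder n X \<in> sets increments"
  using assms by (subst cylinder_eq_prod_emb) (auto intro!: sets_PiM_I simp: sets_step)

context
  fixes A assumes A: "A \<in> shift_invariant_events G"
begin

text \<open>Its probability, as a function of \<open>x\<close>, is the bounded harmonic function
  attached to \<open>A\<close>. What is hit is a set of trajectories, not of group elements.\<close>

definition hitting_event :: "'a \<Rightarrow> (nat \<Rightarrow> 'a) set" where
  "hitting_event x = {g \<in> space increments. trajectory x g \<in> A}"

lemma sets_hitting_event:
  assumes "x \<in> carrier G"
  shows "hitting_event x \<in> sets increments"
proof -
  have "hitting_event x = trajectory x -` A \<inter> space increments"
    by (auto simp: hitting_event_def)
  then show ?thesis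
    using measurable_sets[OF measurable_trajectory[OF assms]] A
    by (auto simp: shift_invariant_events_def)
qed

text \<open>Shift invariance of \<open>A\<close> allows the first position to be dropped, which
  moves the first increment into the starting point.\<close>

lemma hitting_event_case_nat:
  assumes "x \<in> carrier G" "a \<in> carrier G" "g \<in> space increments"
  shows "case_nat a g \<in> hitting_event x \<longleftrightarrow> g \<in> hitting_event (x \<otimes> a)"
proof -
  have "trajectory x (case_nat a g) \<in> space (path_space G)"
    using assms by (intro trajectory_in_path_space case_nat_increments)
  then have "trajectory x (case_nat a g) \<in> A \<longleftrightarrow> path_shift (trajectory x (case_nat a g)) \<in> A"
    using A by (auto simp: shift_invariant_events_def)
  then show ?thesis
    using assms by (simp add: hitting_event_def trajectory_case_nat case_nat_increments)
qed

lemma emeasure_hitting_event_step: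
  assumes x: "x \<in> carrier G"
  shows "emeasure increments (hitting_event x) = (\<integral>\<^sup>+a. emeasure increments (hitting_event (x \<otimes> a)) \<partial>\<mu>)"
  unfolding emeasure_increments_step[OF sets_hitting_event[OF x]]
proof (rule nn_integral_cong)
  fix a assume "a \<in> space \<mu>"
  then have "{g \<in> space increments. case_nat a g \<in> hitting_event x} = hitting_event (x \<otimes> a)"
    using x hitting_event_case_nat[of x a] by (auto simp: space_step) (auto simp: hitting_event_def)
  then show "emeasure increments {g \<in> space increments. case_nat a g \<in> hitting_event x} =
      emeasure increments (hitting_event (x \<otimes> a))"
    by simp
qed

text \<open>Peeling off the first increment moves the start from \<open>x\<close> to
  \<open>x \<otimes> a\<close> and leaves a cylinder in one coordinate less. By \<open>const\<close>
  the moved start has the same probability, so only the factor for \<open>X 0\<close> is gained. The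
  start varies along the way, hence the induction over all \<open>x\<close>.\<close>

lemma emeasure_hitting_event_cylinder:
  assumes const: "\<And>x. x \<in> carrier G \<Longrightarrow>
      AE a in \<mu>. emeasure increments (hitting_event (x \<otimes> a)) = emeasure increments (hitting_event x)"
    and x: "x \<in> carrier G" and X: "\<And>i. X i \<subseteq> carrier G"
  shows "emeasure increments (hitting_event x \<inter> cylinder n X) =
    emeasure increments (hitting_event x) * (\<Prod>i<n. emeasure \<mu> (X i))"
  using x X
proof (induction n arbitrary: x X)
  case 0
  have "hitting_event x \<inter> cylinder 0 X = hitting_event x"
    by (auto simp: hitting_event_def cylinder_def)
  then show ?case
    by simp
next
  case (Suc n)
  let ?c = "\<Prod>i<n. emeasure \<mu> (X (Suc i))"
  have "hitting_event x \<inter> cylinder (Suc n) X \<in> sets increments"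
    using Suc.prems by (intro sets.Int sets_hitting_event sets_cylinder)
  then have "emeasure increments (hitting_event x \<inter> cylinder (Suc n) X) =
      (\<integral>\<^sup>+a. emeasure increments {g \<in> space increments. case_nat a g \<in> hitting_event x \<inter> cylinder (Suc n) X} \<partial>\<mu>)"
    by (rule emeasure_increments_step)
  also have "\<dots> = (\<integral>\<^sup>+a. emeasure increments (hitting_event (x \<otimes> a)) * ?c * indicator (X 0) a \<partial>\<mu>)"
  proof (rule nn_integral_cong)
    fix a assume "a \<in> space \<mu>"
    then have a: "a \<in> carrier G"
      by (simp add: space_step)
    have "case_nat a g \<in> cylinder (Suc n) X \<longleftrightarrow> a \<in> X 0 \<and> g \<in> cylinder n (\<lambda>i. X (Suc i))"
      if "g \<in> space increments" for g
      using that a by (simp add: cylinder_def case_nat_increments All_less_Suc2)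
    then have "{g \<in> space increments. case_nat a g \<in> hitting_event x \<inter> cylinder (Suc n) X} =
        (if a \<in> X 0 then hitting_event (x \<otimes> a) \<inter> cylinder n (\<lambda>i. X (Suc i)) else {})"
      using hitting_event_case_nat[OF Suc.prems(1) a] by (auto simp: cylinder_def)
    then show "emeasure increments {g \<in> space increments. case_nat a g \<in> hitting_event x \<inter> cylinder (Suc n) X} =
        emeasure increments (hitting_event (x \<otimes> a)) * ?c * indicator (X 0) a"
      using Suc.IH[of "x \<otimes> a" "\<lambda>i. X (Suc i)"] Suc.prems a by (simp add: indicator_def)
  qed
  also have "\<dots> = (\<integral>\<^sup>+a. (emeasure increments (hitting_event x) * ?c) * indicator (X 0) a \<partial>\<mu>)"
    using const[OF Suc.prems(1)] by (intro nn_integral_cong_AE) auto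
  also have "\<dots> = emeasure increments (hitting_event x) * ?c * emeasure \<mu> (X 0)"
    using Suc.prems by (intro nn_integral_cmult_indicator) (simp add: sets_step)
  finally show ?case
    by (simp add: prod.lessThan_Suc_shift ac_simps del: prod.lessThan_Suc)
qed

lemma measure_walk_law_01:
  assumes const: "\<And>x. x \<in> carrier G \<Longrightarrow>
      AE a in \<mu>. emeasure increments (hitting_event (x \<otimes> a)) = emeasure increments (hitting_event x)"
  shows "measure (walk_law G \<mu>) A \<in> {0, 1}"
proof -
  interpret S: prob_space increments
    by (rule prob_space_increments)
  interpret P: prob_space \<mu>
    by (rule prob_step)
  interpret S: sequence_space \<mu>
    by unfold_locales
  let ?E = "hitting_event \<one>"
  have E: "?E \<in> sets increments"
    by (intro sets_hitting_event) simp
  \<comment> \<open>Restriction to the event and scaling by its probability agree on cylinders,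
    hence everywhere. Evaluated at the event itself, this says that its probability equals its own
    square.\<close>
  have "density increments (indicator ?E) = density increments (\<lambda>_. emeasure increments ?E)"
  proof (rule measure_eqI_PiM_infinite)
    fix B and J :: "nat set"
    assume J: "finite J" and B: "\<And>i. i \<in> J \<Longrightarrow> B i \<in> sets \<mu>"
    \<comment> \<open>Padding with the whole carrier turns a condition on the finite set
      \<open>J\<close> into one on an initial segment.\<close>
    define X where "X i = (if i \<in> J then B i else carrier G)" for i
    have X: "X i \<subseteq> carrier G" for i
      using B by (auto simp: X_def sets_step)
    obtain n where n: "J \<subseteq> {..<n}"
      using finite_nat_iff_bounded J by blast
    have "prod_emb UNIV (\<lambda>_. \<mu>) J (Pi\<^sub>E J B) = cylinder n X"
      using n B by (auto simp: cylinder_def prod_emb_def space_PiM PiE_iff X_def space_step sets_step subset_iff)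
    moreover have "emeasure increments (cylinder n X) = (\<Prod>i<n. emeasure \<mu> (X i))"
      unfolding cylinder_eq_prod_emb[OF X]
      using X by (subst S.emeasure_PiM_emb) (auto simp: sets_step)
    ultimately show "emeasure (density increments (indicator ?E)) (prod_emb UNIV (\<lambda>_. \<mu>) J (Pi\<^sub>E J B)) =
        emeasure (density increments (\<lambda>_. emeasure increments ?E)) (prod_emb UNIV (\<lambda>_. \<mu>) J (Pi\<^sub>E J B))"
      using emeasure_hitting_event_cylinder[OF const one_closed X] E sets_cylinder[of n X, OF X]
      by (simp add: emeasure_density_const emeasure_density nn_integral_indicator flip: indicator_inter_arith)
  next
    show "finite_measure (density increments (indicator ?E))"
      using E by (intro finite_measureI) (simp add: emeasure_density)
  qed simp_all
  then have "emeasure (density increments (indicator ?E)) ?E =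
      emeasure (density increments (\<lambda>_. emeasure increments ?E)) ?E"
    by simp
  then have "emeasure increments ?E = emeasure increments ?E * emeasure increments ?E"
    using E by (simp add: emeasure_density_const emeasure_density nn_integral_indicator flip: indicator_inter_arith)
  then have "S.prob ?E = S.prob ?E * S.prob ?E"
    by (simp add: S.emeasure_eq_measure flip: ennreal_mult)
  then have "S.prob ?E \<in> {0, 1}"
    by simp
  moreover have "measure (walk_law G \<mu>) A = S.prob ?E"
  proof -
    have "walk G -` A \<inter> space increments = ?E"
      by (auto simp: hitting_event_def trajectory_one)
    then show ?thesis
      using A measurable_walk[OF is_group countable_carrier sets_step]
      by (simp add: walk_law_def measure_distr shift_invariant_events_def)
  qed
  ultimately show ?thesis
    by simp
qed

end

text \<open>The probability of an invariant event as a function of the starting point is harmonic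
  and bounded by 1. Sublinear entropy makes it constant along steps in the support of
  \<open>p\<close>, which is what the zero-one law asks for. The law \<open>p\<close> is
  \<open>\<mu>\<close> carried over from the carrier to the whole type.\<close>

theorem trivial_boundary_of_sublinear_entropy:
  assumes p: "measure_pmf p = distr \<mu> (count_space UNIV) (\<lambda>x. x)" "finite (set_pmf p)"
    and H: "\<And>e. e > 0 \<Longrightarrow> \<exists>N>0. entropy_pmf (conv_pow G p N) \<le> e * real N"
  shows "trivial_Poisson_boundary G \<mu>"
  unfolding trivial_Poisson_boundary_def
proof
  fix A assume A: "A \<in> shift_invariant_events G"
  interpret S: prob_space increments
    by (rule prob_space_increments)
  have AE: "(AE x in \<mu>. P x) \<longleftrightarrow> (\<forall>x\<in>set_pmf p. P x)" for P
    unfolding AE_measure_pmf_iff[symmetric] p(1) by (subst AE_distr_iff[OF measurable_step]) auto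
  note sub = set_step_pmf[OF p(1)]
  define f where "f x = S.prob (hitting_event A x)" for x
  have harmonic: "measure_pmf.expectation p (\<lambda>a. f (x \<otimes> a)) = f x" if x: "x \<in> carrier G" for x
  proof -
    have "ennreal (f x) = (\<integral>\<^sup>+a. ennreal (f (x \<otimes> a)) \<partial>\<mu>)"
      using emeasure_hitting_event_step[OF A x] by (simp add: f_def S.emeasure_eq_measure)
    also have "\<dots> = (\<integral>\<^sup>+a. ennreal (f (x \<otimes> a)) \<partial>measure_pmf p)"
      unfolding p(1) by (subst nn_integral_distr[OF measurable_step]) auto
    also have "\<dots> = ennreal (measure_pmf.expectation p (\<lambda>a. f (x \<otimes> a)))"
      by (intro nn_integral_eq_integral integrable_measure_pmf_finite p) (simp add: f_def)
    finally show ?thesis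
      by (subst (asm) ennreal_inj) (auto simp: f_def intro!: integral_nonneg_AE)
  qed
  have "f (x \<otimes> a) = f x" if "x \<in> carrier G" "a \<in> set_pmf p" for x a
    by (rule harmonic_const_of_sublinear_entropy[OF p(2) sub harmonic _ H that, where M=1])
      (auto simp: f_def)
  then show "measure (walk_law G \<mu>) A \<in> {0, 1}"
    by (intro measure_walk_law_01[OF A]) (simp add: AE S.emeasure_eq_measure f_def)
qed

end

text \<open>The index is shifted because \<open>walk G g n\<close> is a product of
  \<open>n + 1\<close> increments. Both sides satisfy the same recursion obtained by conditioning on
  the first increment.\<close>

lemma (in countable_group_walk) emeasure_walk:
  assumes p: "measure_pmf p = distr \<mu> (count_space UNIV) (\<lambda>x. x)"
  shows "emeasure increments {g \<in> space increments. walk G g n \<in> B} =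
    emeasure (measure_pmf (conv_pow G p (Suc n))) B"
proof -
  note sub = set_step_pmf[OF p]
  have S: "{g \<in> space increments. walk G g n \<in> B} \<in> sets increments" for n B
  proof -
    have "(\<lambda>g. walk G g n) \<in> measurable increments (count_space (carrier G))"
      by (rule measurable_compose[OF measurable_walk[OF is_group countable_carrier sets_step, unfolded path_space_def]])
        simp
    from measurable_sets[OF this, of "B \<inter> carrier G"]
    have "(\<lambda>g. walk G g n) -` (B \<inter> carrier G) \<inter> space increments \<in> sets increments"
      by simp
    also have "(\<lambda>g. walk G g n) -` (B \<inter> carrier G) \<inter> space increments =
        {g \<in> space increments. walk G g n \<in> B}"
      by (auto simp: walk_closed)
    finally show ?thesis .
  qed
  have step: "emeasure increments {g \<in> space increments. walk G g n \<in> B} =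
      (\<integral>\<^sup>+a. emeasure increments {g \<in> space increments. walk G (case_nat a g) n \<in> B} \<partial>\<mu>)" for n B
    by (subst emeasure_increments_step[OF S])
      (auto intro!: nn_integral_cong arg_cong[where f="emeasure increments"] simp: space_step case_nat_increments)
  have bind: "emeasure (measure_pmf (conv_pow G p (Suc n))) B =
      (\<integral>\<^sup>+a. emeasure (measure_pmf (conv_pow G p n)) ((\<lambda>x. a \<otimes> x) -` B) \<partial>\<mu>)" for n B
    unfolding conv_pow_Suc_left[OF sub]
    by (simp add: emeasure_bind_pmf p nn_integral_distr[OF measurable_step])
  show ?thesis
  proof (induction n arbitrary: B)
    case 0
    interpret prob_space increments
      by (rule prob_space_increments)
    show ?case
      unfolding step[of 0] bind
      by (intro nn_integral_cong) (auto simp: space_step indicator_def emeasure_space_1)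
  next
    case (Suc n)
    show ?case
      unfolding step[of "Suc n"] bind[of "Suc n"]
    proof (rule nn_integral_cong)
      fix a assume "a \<in> space \<mu>"
      then have "{g \<in> space increments. walk G (case_nat a g) (Suc n) \<in> B} =
          {g \<in> space increments. walk G g n \<in> (\<lambda>x. a \<otimes> x) -` B}"
        by (auto simp: space_step walk_case_nat simp del: walk.simps)
      then show "emeasure increments {g \<in> space increments. walk G (case_nat a g) (Suc n) \<in> B} =
          emeasure (measure_pmf (conv_pow G p (Suc n))) ((\<lambda>x. a \<otimes> x) -` B)"
        by (simp only: Suc.IH)
    qed
  qed
qed

section \<open>Centred walks on the integers\<close>

context
  fixes q :: "int pmf" and D :: real
  assumes fin: "finite (set_pmf q)"
    and D: "\<And>z. z \<in> set_pmf q \<Longrightarrow> \<bar>z - measure_pmf.expectation q real_of_int\<bar> \<le> D"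
begin

private abbreviation "m \<equiv> measure_pmf.expectation q real_of_int"

private lemma D_nonneg: "D \<ge> 0"
proof -
  obtain z where "z \<in> set_pmf q"
    using set_pmf_not_empty[of q] by blast
  from D[OF this] show ?thesis
    by linarith
qed

private lemma expectation_centered: "measure_pmf.expectation q (\<lambda>z. real_of_int z - m) = 0"
  by (subst Bochner_Integration.integral_diff) (auto intro!: integrable_measure_pmf_finite fin)

text \<open>A term linear in the centred step \<open>z - m\<close> has mean zero. Moment bounds thus
  follow from a pointwise expansion in which that term may be ignored.\<close>

private lemma int_step:
  assumes "\<And>s z. z \<in> set_pmf q \<Longrightarrow>
      h (real_of_int s - n * m + (z - m)) \<le> A (real_of_int s - n * m) + B (real_of_int s - n * m) * (z - m)"
  shows "measure_pmf.expectation (conv_pow integer_group q (Suc n)) (\<lambda>s. h (s - Suc n * m)) \<le>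
    measure_pmf.expectation (conv_pow integer_group q n) (\<lambda>s. A (s - n * m))"
  unfolding expectation_conv_pow_Suc[OF fin]
proof (rule expectation_mono_finite)
  fix s
  have "measure_pmf.expectation q (\<lambda>z. h (real_of_int (s \<otimes>\<^bsub>integer_group\<^esub> z) - Suc n * m)) =
      measure_pmf.expectation q (\<lambda>z. h (real_of_int s - n * m + (z - m)))"
    by (simp add: algebra_simps)
  also have "\<dots> \<le> measure_pmf.expectation q (\<lambda>z. A (real_of_int s - n * m) + B (real_of_int s - n * m) * (z - m))"
    using assms by (intro expectation_mono_finite fin)
  also have "\<dots> = A (real_of_int s - n * m)"
    by (subst Bochner_Integration.integral_add)
      (auto intro!: integrable_measure_pmf_finite fin simp: expectation_centered)
  finally show "measure_pmf.expectation q (\<lambda>z. h (real_of_int (s \<otimes>\<^bsub>integer_group\<^esub> z) - Suc n * m)) \<le>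
      A (real_of_int s - n * m)" .
qed (simp add: finite_set_conv_pow fin)

lemma second_moment_conv_pow_int:
  "measure_pmf.expectation (conv_pow integer_group q n) (\<lambda>s. (s - n * m)\<^sup>2) \<le> n * D\<^sup>2"
proof (induction n)
  case (Suc n)
  have "measure_pmf.expectation (conv_pow integer_group q (Suc n)) (\<lambda>s. (s - Suc n * m)\<^sup>2)
      \<le> measure_pmf.expectation (conv_pow integer_group q n) (\<lambda>s. (s - n * m)\<^sup>2 + D\<^sup>2)"
  proof (rule int_step[where A="\<lambda>y. y\<^sup>2 + D\<^sup>2" and B="\<lambda>y. 2 * y"])
    fix s z assume "z \<in> set_pmf q"
    then have "(z - m)\<^sup>2 \<le> D\<^sup>2"
      using D by (simp add: abs_le_square_iff[symmetric] D_nonneg)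
    then show "(real_of_int s - n * m + (z - m))\<^sup>2 \<le>
        (real_of_int s - n * m)\<^sup>2 + D\<^sup>2 + 2 * (real_of_int s - n * m) * (z - m)"
      by (subst power2_sum) simp
  qed
  also have "\<dots> = measure_pmf.expectation (conv_pow integer_group q n) (\<lambda>s. (s - n * m)\<^sup>2) + D\<^sup>2"
    by (subst Bochner_Integration.integral_add) (auto intro!: integrable_measure_pmf_finite finite_set_conv_pow fin)
  finally show ?case
    using Suc by (simp add: algebra_simps)
qed simp

lemma fourth_moment_conv_pow_int:
  "measure_pmf.expectation (conv_pow integer_group q n) (\<lambda>s. (s - n * m) ^ 4) \<le> 4 * D ^ 4 * (real n)\<^sup>2"
proof (induction n)
  case (Suc n)
  have "measure_pmf.expectation (conv_pow integer_group q (Suc n)) (\<lambda>s. (s - Suc n * m) ^ 4)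
      \<le> measure_pmf.expectation (conv_pow integer_group q n) (\<lambda>s. (s - n * m) ^ 4 + 8 * D\<^sup>2 * (s - n * m)\<^sup>2 + 3 * D ^ 4)"
  \<comment> \<open>Binomial expansion with \<open>Y\<close> the centred position and
    \<open>Z\<close> the centred step. The term linear in \<open>Z\<close> goes into
    \<open>B\<close>; the quadratic one contributes 6 to the coefficient 8, the cubic one 2 to it
    and 2 to the coefficient 3, the quartic one the remaining 1.\<close>
  proof (rule int_step[where A="\<lambda>y. y ^ 4 + 8 * D\<^sup>2 * y\<^sup>2 + 3 * D ^ 4" and B="\<lambda>y. 4 * y ^ 3"])
    fix s z assume "z \<in> set_pmf q"
    define Y Z where "Y = real_of_int s - n * m" and "Z = real_of_int z - m"
    have Z: "\<bar>Z\<bar> \<le> D"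
      using D \<open>z \<in> set_pmf q\<close> by (simp add: Z_def)
    then have Z2: "Z\<^sup>2 \<le> D\<^sup>2"
      by (simp add: abs_le_square_iff[symmetric] D_nonneg)
    have "Z ^ 3 * Y \<le> \<bar>Z ^ 3 * Y\<bar>"
      by simp
    also have "\<dots> = Z\<^sup>2 * (\<bar>Z\<bar> * \<bar>Y\<bar>)"
      by (simp add: abs_mult power3_eq_cube power2_eq_square)
    also have "\<dots> \<le> D\<^sup>2 * (D * \<bar>Y\<bar>)"
      using Z Z2 by (intro mult_mono) auto
    also have "\<dots> \<le> D\<^sup>2 * ((D\<^sup>2 + Y\<^sup>2) / 2)"
      using sum_squares_bound[of D "\<bar>Y\<bar>"] by (intro mult_left_mono) auto
    finally have 3: "4 * (Z ^ 3 * Y) \<le> 2 * D\<^sup>2 * Y\<^sup>2 + 2 * D ^ 4"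
      by (simp add: algebra_simps power_numeral_reduce)
    have 2: "6 * (Z\<^sup>2 * Y\<^sup>2) \<le> 6 * (D\<^sup>2 * Y\<^sup>2)"
      using Z2 by (simp add: mult_right_mono)
    have 4: "Z ^ 4 \<le> D ^ 4"
      using power_mono[OF Z2, of 2] by simp
    have "(Y + Z) ^ 4 = Y ^ 4 + 4 * Y ^ 3 * Z + 6 * (Z\<^sup>2 * Y\<^sup>2) + 4 * (Z ^ 3 * Y) + Z ^ 4"
      by (simp add: algebra_simps power_numeral_reduce)
    then show "(real_of_int s - n * m + (z - m)) ^ 4 \<le>
        (real_of_int s - n * m) ^ 4 + 8 * D\<^sup>2 * (real_of_int s - n * m)\<^sup>2 + 3 * D ^ 4
        + 4 * (real_of_int s - n * m) ^ 3 * (z - m)"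
      using 2 3 4 unfolding Y_def[symmetric] Z_def[symmetric] by linarith
  qed
  also have "\<dots> = measure_pmf.expectation (conv_pow integer_group q n) (\<lambda>s. (s - n * m) ^ 4)
      + 8 * D\<^sup>2 * measure_pmf.expectation (conv_pow integer_group q n) (\<lambda>s. (s - n * m)\<^sup>2) + 3 * D ^ 4"
    by (simp add: integrable_measure_pmf_finite finite_set_conv_pow fin)
  also have "\<dots> \<le> 4 * D ^ 4 * (real n)\<^sup>2 + 8 * D\<^sup>2 * (n * D\<^sup>2) + 3 * D ^ 4"
    using Suc second_moment_conv_pow_int[of n] by (intro add_mono mult_left_mono) auto
  \<comment> \<open>Here \<open>8 * n + 3\<close> is at most \<open>4 * (2 * n + 1)\<close>, the
    increment of \<open>4 * n\<^sup>2\<close>.\<close>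
  also have "\<dots> \<le> 4 * D ^ 4 * (real (Suc n))\<^sup>2"
    using zero_le_power[OF D_nonneg, of 4] by (simp add: algebra_simps power_numeral_reduce)
  finally show ?case .
qed simp

text \<open>With nonzero drift, being at 0 at time \<open>n\<close> is a deviation of order
  \<open>n\<close> from the mean. Markov's inequality for the fourth moment bounds its probability
  by a multiple of \<open>1 / n\<^sup>2\<close>, which is summable, unlike the \<open>1 / n\<close>
  from the variance. Borel-Cantelli then contradicts recurrence.\<close>

lemma recurrent_imp_mean_zero:
  assumes rec: "recurrent_walk integer_group (measure_pmf q)"
  shows "m = 0"
proof (rule ccontr)
  assume m: "m \<noteq> 0"
  interpret W: countable_group_walk integer_group "measure_pmf q"
    by (intro countable_group_walk.intro countable_group_walk_axioms.intro)
      (auto simp: measure_pmf.prob_space_axioms)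
  let ?L = "walk_law integer_group (measure_pmf q)"
  interpret L: prob_space ?L
    by (rule prob_space_walk_law) (auto simp: measure_pmf.prob_space_axioms)
  interpret I: prob_space W.increments
    by (rule W.prob_space_increments)
  define Z where "Z n = {x \<in> space ?L. x n = 0}" for n :: nat
  have walk: "walk integer_group \<in> measurable W.increments (path_space integer_group)"
    by (rule measurable_walk) auto
  have Z: "Z n \<in> sets ?L" for n
  proof -
    have "(\<lambda>x. x n) \<in> measurable (path_space integer_group) (count_space UNIV)"
      unfolding path_space_def carrier_integer_group by simp
    from measurable_sets[OF this, of "{0}"]
    show ?thesis
      by (simp add: Z_def walk_law_def vimage_def Int_def conj_commute)
  qed
  have divide_out: "P \<le> c / m ^ 4 * (1 / N\<^sup>2)" if "P * (N * m) ^ 4 \<le> c * N\<^sup>2" "N > 0" for P c N :: real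
  proof -
    have "(P * (N\<^sup>2 * m ^ 4)) * N\<^sup>2 \<le> c * N\<^sup>2"
      using that(1) by (simp add: power_mult_distrib power_numeral_reduce ac_simps)
    then have "P * (N\<^sup>2 * m ^ 4) \<le> c"
      by (rule mult_right_le_imp_le) (use that(2) in simp)
    moreover have "N\<^sup>2 * m ^ 4 > 0"
      using m that(2) by simp
    ultimately have "P \<le> c / (N\<^sup>2 * m ^ 4)"
      by (simp only: pos_le_divide_eq)
    then show ?thesis
      by (simp add: mult.commute)
  qed
  have prob_Z: "measure ?L (Z n) \<le> 4 * D ^ 4 / m ^ 4 * (1 / real (Suc n) ^ 2)" for n
  proof -
    let ?c = "conv_pow integer_group q (Suc n)"
    have "emeasure ?L (Z n) = emeasure W.increments {g \<in> space W.increments. walk integer_group g n \<in> {0}}"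
      using walk Z[of n] measurable_space[OF walk] unfolding walk_law_def
      by (subst emeasure_distr) (auto simp: Z_def walk_law_def intro!: arg_cong[where f="emeasure W.increments"])
    also have "\<dots> = emeasure (measure_pmf ?c) {0}"
      by (rule W.emeasure_walk) (metis distr_id2 sets_measure_pmf_count_space)
    finally have "measure ?L (Z n) = pmf ?c 0"
      by (simp add: L.emeasure_eq_measure measure_pmf.emeasure_eq_measure measure_pmf_single del: conv_pow.simps)
    moreover have "pmf ?c 0 * (Suc n * m) ^ 4 \<le> 4 * D ^ 4 * (real (Suc n))\<^sup>2"
    proof -
      \<comment> \<open>The point 0 may lie outside the support; adding it lets its term be singled
        out from the sum of nonnegative terms.\<close>
      let ?S = "insert 0 (set_pmf ?c)"
      have S: "finite ?S" "set_pmf ?c \<subseteq> ?S"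
        using finite_set_conv_pow[OF fin, of integer_group "Suc n"] by auto
      have "pmf ?c 0 * (real_of_int 0 - Suc n * m) ^ 4 \<le> (\<Sum>s\<in>?S. pmf ?c s * (real_of_int s - Suc n * m) ^ 4)"
        using S(1) by (intro member_le_sum) (auto simp del: conv_pow.simps)
      also have "\<dots> = measure_pmf.expectation ?c (\<lambda>s. (s - Suc n * m) ^ 4)"
        by (rule expectation_superset[OF S, symmetric])
      also have "\<dots> \<le> 4 * D ^ 4 * (real (Suc n))\<^sup>2"
        by (rule fourth_moment_conv_pow_int)
      finally show ?thesis
        by (simp del: conv_pow.simps of_nat_Suc)
    qed
    ultimately show ?thesis
      using divide_out[of _ "real (Suc n)"] by (simp del: conv_pow.simps of_nat_Suc)
  qed
  have "summable (\<lambda>n. 1 / real (Suc n) ^ 2)"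
    using inverse_power_summable[of 2, where 'a=real] by (subst summable_Suc_iff) (simp add: inverse_eq_divide)
  then have "summable (\<lambda>n. 4 * D ^ 4 / m ^ 4 * (1 / real (Suc n) ^ 2))"
    by (rule summable_mult)
  then have "summable (\<lambda>n. measure ?L (Z n))"
    by (rule summable_comparison_test'[where N=0]) (use prob_Z in auto)
  then have "AE x in ?L. eventually (\<lambda>n. x \<in> space ?L - Z n) sequentially"
    using Z by (intro borel_cantelli_AE1) (auto simp: L.emeasure_eq_measure)
  moreover have "AE x in ?L. infinite {n. x n = 0}"
    using rec by (simp add: recurrent_walk_def)
  ultimately have "AE x in ?L. False"
  proof eventually_elim
    case (elim x)
    then obtain N where "\<And>n. n \<ge> N \<Longrightarrow> x n \<noteq> 0"
      by (auto simp: eventually_sequentially Z_def)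
    then have "{n. x n = 0} \<subseteq> {..<N}"
      by (auto simp: not_le[symmetric])
    then show ?case
      using elim finite_subset by blast
  qed
  then show False
    by simp
qed

end

section \<open>The entropy of walks on the shuffler group\<close>

text \<open>The weight \<open>w\<close> gives the points of radius \<open>R\<close> total mass at
  most \<open>1 / 2 ^ Suc R\<close>, in portions of \<open>1 / K R\<close> of that mass. These
  masses sum to at most 1, and Gibbs' inequality applies.\<close>

lemma entropy_pmf_le_of_growth:
  fixes rad :: "'a \<Rightarrow> nat"
  assumes fin: "finite (set_pmf p)"
    and card: "\<And>R. card {x \<in> set_pmf p. rad x = R} \<le> K R" and K: "\<And>R. K R > 0"
  shows "entropy_pmf p \<le> measure_pmf.expectation p (\<lambda>x. ln (real (K (rad x))) + (real (rad x) + 1) * ln 2)"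
proof -
  define w where "w x = 1 / (real (K (rad x)) * 2 ^ Suc (rad x))" for x
  have "(\<Sum>x\<in>set_pmf p. w x) = (\<Sum>R\<in>rad ` set_pmf p. \<Sum>x\<in>{x \<in> set_pmf p. rad x = R}. w x)"
    by (rule sum.image_gen[OF fin])
  also have "\<dots> = (\<Sum>R\<in>rad ` set_pmf p. real (card {x \<in> set_pmf p. rad x = R}) * (1 / (real (K R) * 2 ^ Suc R)))"
    by (simp add: w_def)
  also have "\<dots> \<le> (\<Sum>R\<in>rad ` set_pmf p. real (K R) * (1 / (real (K R) * 2 ^ Suc R)))"
    using card by (intro sum_mono mult_right_mono) auto
  also have "\<dots> = (\<Sum>R\<in>rad ` set_pmf p. (1 / 2) ^ Suc R)"
    using K by (intro sum.cong) (simp_all add: power_divide less_imp_neq[symmetric] field_simps)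
  also have "\<dots> \<le> (\<Sum>R. (1 / 2) ^ Suc R)"
    using fin power_half_series by (intro sum_le_suminf) (auto simp: sums_iff)
  also have "\<dots> = 1"
    using power_half_series by (simp add: sums_iff)
  finally have "entropy_pmf p \<le> measure_pmf.expectation p (\<lambda>x. - ln (w x))"
    using K by (intro entropy_pmf_le_cross_entropy[OF fin]) (auto simp: w_def)
  also have "(\<lambda>x. - ln (w x)) = (\<lambda>x. ln (real (K (rad x))) + (real (rad x) + 1) * ln 2)"
    using K by (auto simp: w_def ln_div ln_mult ln_realpow algebra_simps simp flip: power_Suc intro!: ext)
  finally show ?thesis .
qed

section \<open>Counting and growth of supports in the shuffler group\<close>

definition shuffler_ball :: "nat \<Rightarrow> ((int \<Rightarrow> int) \<times> int) set" where
  "shuffler_ball R = {(f, s). (f, s) \<in> carrier Shuffler \<and> (\<forall>x. f x \<noteq> x \<longrightarrow> \<bar>x\<bar> \<le> int R) \<and> \<bar>s\<bar> \<le> int R}"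

definition shuffler_radius :: "(int \<Rightarrow> int) \<times> int \<Rightarrow> nat" where
  "shuffler_radius x = (LEAST R. x \<in> shuffler_ball R)"

lemma shuffler_ball_mono: "R \<le> R' \<Longrightarrow> shuffler_ball R \<subseteq> shuffler_ball R'"
  by (fastforce simp: shuffler_ball_def)

text \<open>A permutation that is the identity off the interval maps the interval to itself, so it
  is determined by a self-map of \<open>2 * R + 1\<close> points; one more factor counts the
  position. The logarithm of this crude count is of order \<open>R * ln R\<close>, which is good
  enough for sublinear entropy.\<close>

lemma card_shuffler_ball:
  "finite (shuffler_ball R) \<and> card (shuffler_ball R) \<le> (2 * R + 1) ^ (2 * R + 2)"
proof -
  define I where "I = {- int R .. int R}"
  define T where "T = (I \<rightarrow>\<^sub>E I) \<times> I"
  define r where "r = (\<lambda>(f :: int \<Rightarrow> int, s :: int). (restrict f I, s))"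
  have I: "finite I" "card I = 2 * R + 1"
    by (auto simp: I_def)
  have T: "finite T" "card T = (2 * R + 1) ^ (2 * R + 2)"
    using I by (auto simp: T_def card_PiE finite_PiE card_cartesian_product)
  have "r ` shuffler_ball R \<subseteq> T"
  proof
    fix y assume "y \<in> r ` shuffler_ball R"
    then obtain f s where y: "y = (restrict f I, s)" and f: "bij f" and
      supp: "\<And>x. f x \<noteq> x \<Longrightarrow> \<bar>x\<bar> \<le> int R" and s: "\<bar>s\<bar> \<le> int R"
      by (auto simp: r_def shuffler_ball_def Shuffler_def FSym_def)
    have "f x \<in> I" if "x \<in> I" for x
    proof (cases "f x = x")
      case False
      \<comment> \<open>By injectivity a moved point has a moved image, so the image lies in the
        support as well.\<close>
      then have "f (f x) \<noteq> f x"
        using bij_is_inj[OF f] by (auto dest: injD)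
      from supp[OF this] show ?thesis
        by (auto simp: I_def)
    qed (use that in simp)
    moreover have "s \<in> I"
      using s by (auto simp: I_def)
    ultimately show "y \<in> T"
      by (auto simp: y T_def)
  qed
  moreover have "inj_on r (shuffler_ball R)"
  proof (rule inj_onI)
    fix a b assume a: "a \<in> shuffler_ball R" and b: "b \<in> shuffler_ball R" and eq: "r a = r b"
    obtain f s g t where fg: "a = (f, s)" "b = (g, t)"
      by (cases a; cases b)
    have "f x = g x" for x
    proof (cases "x \<in> I")
      case True
      moreover have "restrict f I x = restrict g I x"
        using eq by (simp add: fg r_def)
      ultimately show ?thesis
        by simp
    next
      case False
      then have "f x = x" "g x = x"
        using a b by (auto simp: fg shuffler_ball_def I_def abs_le_iff)
      then show ?thesis
        by simp
    qed
    then have "f = g"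
      by (rule ext)
    then show "a = b"
      using eq by (simp add: fg r_def)
  qed
  ultimately have "finite (shuffler_ball R)" "card (shuffler_ball R) \<le> card T"
    using T(1) by (auto intro: inj_on_finite card_inj_on_le)
  then show ?thesis
    using T(2) by simp
qed

lemma in_shuffler_ball_radius:
  assumes "x \<in> carrier Shuffler"
  shows "x \<in> shuffler_ball (shuffler_radius x)"
proof -
  obtain f s where x: "x = (f, s)"
    by (cases x)
  have "finite (insert s {y. f y \<noteq> y})"
    using assms by (auto simp: x Shuffler_def FSym_def)
  then have "finite ((\<lambda>y. nat \<bar>y\<bar>) ` insert s {y. f y \<noteq> y})"
    by (rule finite_imageI)
  then obtain R where "\<forall>k \<in> (\<lambda>y. nat \<bar>y\<bar>) ` insert s {y. f y \<noteq> y}. k \<le> R"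
    using finite_nat_set_iff_bounded_le by blast
  then have "x \<in> shuffler_ball R"
    using assms by (auto simp: x shuffler_ball_def)
  then show ?thesis
    unfolding shuffler_radius_def by (rule LeastI)
qed

lemma shuffler_radius_le: "x \<in> shuffler_ball R \<Longrightarrow> shuffler_radius x \<le> R"
  unfolding shuffler_radius_def by (rule Least_le)

text \<open>The permutation of the increment is transported to the current position \<open>s\<close>
  before it acts, so it moves only points within distance \<open>C\<close> of
  \<open>s\<close>.\<close>

lemma shuffler_mult_ball:
  assumes x: "(f, s) \<in> shuffler_ball R" and a: "a \<in> shuffler_ball C"
  shows "(f, s) \<otimes>\<^bsub>Shuffler\<^esub> a \<in> shuffler_ball (max R (nat \<bar>s\<bar> + C))"
proof -
  obtain g z where g: "a = (g, z)"
    by (cases a)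
  have "(f, s) \<otimes>\<^bsub>Shuffler\<^esub> a \<in> carrier Shuffler"
    using x a by (intro monoid.m_closed group.is_monoid group_Shuffler) (auto simp: shuffler_ball_def g)
  moreover have "(f, s) \<otimes>\<^bsub>Shuffler\<^esub> a = (f \<circ> shift_act s g, s + z)"
    by (simp add: g Shuffler_def FSym_def)
  moreover have "\<bar>y\<bar> \<le> int (max R (nat \<bar>s\<bar> + C))" if y: "(f \<circ> shift_act s g) y \<noteq> y" for y
  proof (cases "g (y - s) = y - s")
    case True
    then have "f y \<noteq> y"
      using y by (simp add: shift_act_def)
    then show ?thesis
      using x by (fastforce simp: shuffler_ball_def)
  next
    case False
    then have "\<bar>y - s\<bar> \<le> int C"
      using a by (auto simp: shuffler_ball_def g)
    then show ?thesis
      by linarith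
  qed
  ultimately show ?thesis
    using a by (auto simp: shuffler_ball_def g)
qed

lemma shuffler_radius_mult:
  assumes "x \<in> carrier Shuffler" "a \<in> shuffler_ball C"
  shows "shuffler_radius (x \<otimes>\<^bsub>Shuffler\<^esub> a) \<le> max (shuffler_radius x) (nat \<bar>snd x\<bar> + C)"
  using shuffler_mult_ball[of "fst x" "snd x" "shuffler_radius x" a C] in_shuffler_ball_radius[OF assms(1)] assms(2)
  by (auto intro: shuffler_radius_le)

lemma abs_snd_le_shuffler_radius: "x \<in> carrier Shuffler \<Longrightarrow> nat \<bar>snd x\<bar> \<le> shuffler_radius x"
  using in_shuffler_ball_radius[of x] by (auto simp: shuffler_ball_def)

lemma map_snd_conv_pow_Shuffler:
  "map_pmf snd (conv_pow Shuffler p n) = conv_pow integer_group (map_pmf snd p) n"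
proof (induction n)
  case (Suc n)
  have "map_pmf snd (conv_pow Shuffler p (Suc n)) =
      conv_pow Shuffler p n \<bind> (\<lambda>x. map_pmf (\<lambda>a. snd x + snd a) p)"
    by (simp add: map_bind_pmf pmf.map_comp o_def Shuffler_def case_prod_beta)
  also have "\<dots> = map_pmf snd (conv_pow Shuffler p n) \<bind> (\<lambda>s. map_pmf (\<lambda>z. s + z) (map_pmf snd p))"
    by (simp add: bind_map_pmf pmf.map_comp o_def)
  finally show ?case
    by (simp add: Suc)
qed (simp add: Shuffler_def)

section \<open>Expected radius and entropy of a centred walk\<close>

context
  fixes p :: "((int \<Rightarrow> int) \<times> int) pmf" and C :: nat
  assumes fin: "finite (set_pmf p)" and C: "set_pmf p \<subseteq> shuffler_ball C" "C > 0"
    and mean: "measure_pmf.expectation p (\<lambda>a. real_of_int (snd a)) = 0"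
begin

private lemma set_p: "set_pmf p \<subseteq> carrier Shuffler"
  using C(1) by (auto simp: shuffler_ball_def)

private lemmas set_conv = group.set_conv_pow[OF group_Shuffler set_p]
private lemmas fin_conv = finite_set_conv_pow[OF fin, of Shuffler]

text \<open>A deterministic bound, far from the true order; it serves inside a logarithm and at time
  0.\<close>

private lemma shuffler_radius_linear:
  "x \<in> set_pmf (conv_pow Shuffler p n) \<Longrightarrow> shuffler_radius x \<le> C * n"
proof (induction n arbitrary: x)
  case 0
  have "\<one>\<^bsub>Shuffler\<^esub> \<in> shuffler_ball 0"
    using monoid.one_closed[OF group.is_monoid[OF group_Shuffler]]
    by (auto simp: shuffler_ball_def Shuffler_def FSym_def)
  then show ?case
    using 0 shuffler_radius_le[of "\<one>\<^bsub>Shuffler\<^esub>" 0] by simp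
next
  case (Suc n)
  then obtain y a where y: "y \<in> set_pmf (conv_pow Shuffler p n)" and a: "a \<in> set_pmf p"
    and x: "x = y \<otimes>\<^bsub>Shuffler\<^esub> a"
    by auto
  have "y \<in> carrier Shuffler"
    using y set_conv by auto
  then show ?case
    using shuffler_radius_mult[of y a C] abs_snd_le_shuffler_radius[of y] Suc.IH[OF y] a C(1)
    by (auto simp: x)
qed

private lemma fourth_moment_snd:
  "measure_pmf.expectation (conv_pow Shuffler p n) (\<lambda>x. real_of_int (snd x) ^ 4) \<le> 4 * real C ^ 4 * (real n)\<^sup>2"
proof -
  have m: "measure_pmf.expectation (map_pmf snd p) real_of_int = 0"
    using mean by simp
  have "measure_pmf.expectation (conv_pow integer_group (map_pmf snd p) n) (\<lambda>s. (real_of_int s - real n * 0) ^ 4) \<le> 4 * real C ^ 4 * (real n)\<^sup>2"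
  proof (rule fourth_moment_conv_pow_int[where q="map_pmf snd p", unfolded m])
    fix z assume "z \<in> set_pmf (map_pmf snd p)"
    then have "\<bar>z\<bar> \<le> int C"
      using C(1) by (auto simp: shuffler_ball_def)
    then show "\<bar>real_of_int z - 0\<bar> \<le> real C"
      by linarith
  qed (simp add: fin)
  then show ?thesis
    by (simp flip: map_snd_conv_pow_Shuffler)
qed

text \<open>Subtracting \<open>C\<close> absorbs the step size: one step replaces the truncated
  radius by at most its maximum with \<open>\<bar>snd x\<bar>\<close>. The fourth power matches the
  available moment of the position.\<close>

private definition excess :: "(int \<Rightarrow> int) \<times> int \<Rightarrow> real" where
  "excess x = max 0 (real (shuffler_radius x) - real C) ^ 4"

text \<open>The support at time \<open>n + 1\<close> exceeds the one at time \<open>n\<close> at most within distance \<open>C\<close> of the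
  current position, so the excess radius is at most the running maximum of \<open>\<bar>S\<^sub>k\<bar>\<close>, which
  is crudely bounded by the \<open>\<ell>\<^sup>4\<close>-norm of \<open>S\<^sub>0, \<dots>, S\<^sub>n\<close>.\<close>

private lemma expectation_excess:
  "measure_pmf.expectation (conv_pow Shuffler p n) excess \<le> 4 * real C ^ 4 * real n ^ 3"
proof (induction n)
  case 0
  have "shuffler_radius \<one>\<^bsub>Shuffler\<^esub> = 0"
    using shuffler_radius_linear[of _ 0] by simp
  then show ?case
    by (simp add: excess_def)
next
  case (Suc n)
  have "excess (x \<otimes>\<^bsub>Shuffler\<^esub> a) \<le> excess x + real_of_int (snd x) ^ 4"
    if x: "x \<in> set_pmf (conv_pow Shuffler p n)" and a: "a \<in> set_pmf p" for x a
  proof -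
    let ?u = "max 0 (real (shuffler_radius x) - real C)"
    have "shuffler_radius (x \<otimes>\<^bsub>Shuffler\<^esub> a) \<le> max (shuffler_radius x) (nat \<bar>snd x\<bar> + C)"
      using x a set_conv C(1) by (intro shuffler_radius_mult) auto
    then have "max 0 (real (shuffler_radius (x \<otimes>\<^bsub>Shuffler\<^esub> a)) - real C) \<le> max ?u \<bar>real_of_int (snd x)\<bar>"
      by linarith
    then have "excess (x \<otimes>\<^bsub>Shuffler\<^esub> a) \<le> max ?u \<bar>real_of_int (snd x)\<bar> ^ 4"
      unfolding excess_def by (rule power_mono) simp
    also have "\<dots> \<le> ?u ^ 4 + \<bar>real_of_int (snd x)\<bar> ^ 4"
      by (simp add: max_def)
    finally show ?thesis
      by (simp add: excess_def)
  qed
  then have *: "measure_pmf.expectation p (\<lambda>a. excess (x \<otimes>\<^bsub>Shuffler\<^esub> a)) \<le>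
      measure_pmf.expectation p (\<lambda>a. excess x + real_of_int (snd x) ^ 4)"
    if "x \<in> set_pmf (conv_pow Shuffler p n)" for x
    using that by (intro expectation_mono_finite fin)
  have "measure_pmf.expectation (conv_pow Shuffler p (Suc n)) excess \<le>
      measure_pmf.expectation (conv_pow Shuffler p n) (\<lambda>x. excess x + real_of_int (snd x) ^ 4)"
    unfolding expectation_conv_pow_Suc[OF fin] using * by (intro expectation_mono_finite fin_conv) simp
  also have "\<dots> = measure_pmf.expectation (conv_pow Shuffler p n) excess +
      measure_pmf.expectation (conv_pow Shuffler p n) (\<lambda>x. real_of_int (snd x) ^ 4)"
    by (intro Bochner_Integration.integral_add integrable_measure_pmf_finite fin_conv)
  also have "\<dots> \<le> 4 * real C ^ 4 * real n ^ 3 + 4 * real C ^ 4 * (real n)\<^sup>2"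
    by (intro add_mono Suc.IH fourth_moment_snd)
  also have "\<dots> = 4 * real C ^ 4 * (real n ^ 3 + (real n)\<^sup>2)"
    by (simp add: algebra_simps)
  also have "\<dots> \<le> 4 * real C ^ 4 * real (Suc n) ^ 3"
    by (intro mult_left_mono) (auto simp: algebra_simps power_numeral_reduce)
  finally show ?case .
qed

text \<open>A Markov-type truncation: a value \<open>u >= L\<close> is at most
  \<open>u ^ 4 / L ^ 3\<close>. The threshold \<open>L\<close> is left open for later
  optimisation.\<close>

private lemma expectation_shuffler_radius:
  fixes L :: real
  assumes L: "L > 0"
  shows "measure_pmf.expectation (conv_pow Shuffler p n) (\<lambda>x. real (shuffler_radius x))
    \<le> real C + L + 4 * real C ^ 4 * real n ^ 3 / L ^ 3"
proof -
  have "real (shuffler_radius x) \<le> real C + L + excess x / L ^ 3" for x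
  proof (cases "real (shuffler_radius x) - C \<le> L")
    case True
    then show ?thesis
      using L by (auto simp: excess_def add_increasing2)
  next
    case False
    define u where "u = real (shuffler_radius x) - C"
    have u: "L \<le> u"
      using False by (simp add: u_def)
    have "u * L ^ 3 \<le> u * u ^ 3"
      using u L by (intro mult_left_mono power_mono) auto
    then have "u \<le> u ^ 4 / L ^ 3"
      using L by (simp add: field_simps power_numeral_reduce)
    also have "u ^ 4 = excess x"
      using u L by (simp add: excess_def u_def)
    finally show ?thesis
      using L by (simp add: u_def)
  qed
  then have "measure_pmf.expectation (conv_pow Shuffler p n) (\<lambda>x. real (shuffler_radius x))
      \<le> measure_pmf.expectation (conv_pow Shuffler p n) (\<lambda>x. real C + L + excess x / L ^ 3)"
    by (intro expectation_mono_finite fin_conv)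
  also have "\<dots> = real C + L + measure_pmf.expectation (conv_pow Shuffler p n) excess / L ^ 3"
    by (simp add: integrable_measure_pmf_finite fin_conv)
  also have "\<dots> \<le> real C + L + 4 * real C ^ 4 * real n ^ 3 / L ^ 3"
    using L expectation_excess[of n] by (intro add_left_mono divide_right_mono) auto
  finally show ?thesis .
qed

text \<open>The count of balls gives about \<open>R * ln R\<close> for radius \<open>R\<close>.
  Inside the logarithm the radius is replaced by its linear bound, after which the expression is
  linear in the radius and only its mean matters.\<close>

private lemma entropy_conv_pow_Shuffler_le:
  fixes L :: real
  assumes L: "L > 0"
  shows "entropy_pmf (conv_pow Shuffler p n) \<le>
    2 * (ln (2 * C * real n + 1) + 1) * (1 + real C + L + 4 * real C ^ 4 * real n ^ 3 / L ^ 3)"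
proof -
  let ?q = "conv_pow Shuffler p n"
  let ?c = "2 * (ln (2 * C * real n + 1) + 1)"
  have c: "?c \<ge> 0"
    by (intro mult_nonneg_nonneg add_nonneg_nonneg ln_ge_zero) auto
  have "card {x \<in> set_pmf ?q. shuffler_radius x = R} \<le> (2 * R + 1) ^ (2 * R + 2)" for R
  proof -
    have "{x \<in> set_pmf ?q. shuffler_radius x = R} \<subseteq> shuffler_ball R"
      using in_shuffler_ball_radius set_conv by auto
    then show ?thesis
      using card_shuffler_ball[of R] card_mono le_trans by blast
  qed
  then have "entropy_pmf ?q \<le> measure_pmf.expectation ?q (\<lambda>x.
      ln (real ((2 * shuffler_radius x + 1) ^ (2 * shuffler_radius x + 2))) + (real (shuffler_radius x) + 1) * ln 2)"
    by (intro entropy_pmf_le_of_growth fin_conv) auto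
  also have "\<dots> \<le> measure_pmf.expectation ?q (\<lambda>x. ?c * (1 + real (shuffler_radius x)))"
  proof (intro expectation_mono_finite fin_conv)
    fix x assume "x \<in> set_pmf ?q"
    let ?R = "real (shuffler_radius x)"
    have "?R \<le> C * real n"
      using shuffler_radius_linear[OF \<open>x \<in> set_pmf ?q\<close>] by (metis of_nat_le_iff of_nat_mult)
    then have "ln (2 * ?R + 1) \<le> ln (2 * C * real n + 1)"
      by (subst ln_le_cancel_iff) (auto simp: add_nonneg_pos)
    then have "(2 * ?R + 2) * ln (2 * ?R + 1) \<le> (2 * ?R + 2) * ln (2 * C * real n + 1)"
      by (intro mult_left_mono) auto
    moreover have "(?R + 1) * ln 2 \<le> (?R + 1) * 2"
      using ln_2_less_1 by (intro mult_left_mono) auto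
    moreover have "ln (real ((2 * shuffler_radius x + 1) ^ (2 * shuffler_radius x + 2))) = (2 * ?R + 2) * ln (2 * ?R + 1)"
      by (simp add: ln_realpow add.commute del: power_Suc power_add)
    ultimately show "ln (real ((2 * shuffler_radius x + 1) ^ (2 * shuffler_radius x + 2))) + (?R + 1) * ln 2 \<le> ?c * (1 + ?R)"
      by (simp add: algebra_simps)
  qed
  also have "\<dots> = ?c * (1 + measure_pmf.expectation ?q (\<lambda>x. real (shuffler_radius x)))"
    by (simp add: integrable_measure_pmf_finite fin_conv)
  also have "\<dots> \<le> ?c * (1 + (real C + L + 4 * real C ^ 4 * real n ^ 3 / L ^ 3))"
    using expectation_shuffler_radius[OF L, of n] c by (intro mult_left_mono add_left_mono)
  finally show ?thesis
    by (simp add: add.assoc)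
qed

text \<open>Balancing \<open>L\<close> against \<open>n ^ 3 / L ^ 3\<close> suggests
  \<open>L\<close> of order \<open>n\<close> to the power 3/4. Taking \<open>n = k ^ 4\<close> and
  \<open>L = k ^ 3\<close> keeps the exponents integral, and the entropy bound is of order
  \<open>k ^ 3 * ln k\<close>.\<close>

lemma entropy_conv_pow_Shuffler_sublinear:
  assumes e: "e > 0"
  shows "\<exists>N>0. entropy_pmf (conv_pow Shuffler p N) \<le> e * real N"
proof -
  define c where "c = real C"
  have c: "c > 0"
    using C(2) by (simp add: c_def)
  have "((\<lambda>k::nat. 2 * (ln (2 * c * real k ^ 4 + 1) + 1) * (1 + c + real k ^ 3 + 4 * c ^ 4 * real k ^ 3) / real k ^ 4)
      \<longlongrightarrow> 0) at_top"
    using c by real_asymp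
  then have "eventually (\<lambda>k::nat. 2 * (ln (2 * c * real k ^ 4 + 1) + 1) * (1 + c + real k ^ 3 + 4 * c ^ 4 * real k ^ 3) / real k ^ 4 < e) at_top"
    using e by (rule order_tendstoD)
  then have "eventually (\<lambda>k::nat. 2 * (ln (2 * c * real k ^ 4 + 1) + 1) * (1 + c + real k ^ 3 + 4 * c ^ 4 * real k ^ 3) / real k ^ 4 < e \<and> k > 0) at_top"
    by (intro eventually_conj eventually_gt_at_top)
  then obtain k :: nat where k: "k > 0" and
    ke: "2 * (ln (2 * c * real k ^ 4 + 1) + 1) * (1 + c + real k ^ 3 + 4 * c ^ 4 * real k ^ 3) / real k ^ 4 < e"
    by (auto simp: eventually_sequentially)
  have "real (k ^ 4) ^ 3 / (real k ^ 3) ^ 3 = real k ^ 3"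
    using k by (simp add: power_mult[symmetric] power_diff[symmetric])
  then have "entropy_pmf (conv_pow Shuffler p (k ^ 4)) \<le>
      2 * (ln (2 * c * real k ^ 4 + 1) + 1) * (1 + c + real k ^ 3 + 4 * c ^ 4 * real k ^ 3)"
    using entropy_conv_pow_Shuffler_le[of "real k ^ 3" "k ^ 4"] k by (simp add: c_def flip: times_divide_eq_right)
  also have "\<dots> \<le> e * real (k ^ 4)"
    using ke k by (simp add: divide_less_eq)
  finally show ?thesis
    using k by (intro exI[of _ "k ^ 4"]) simp
qed

end

theorem proposition6p1:
  fixes \<mu> :: "((int \<Rightarrow> int) \<times> int) measure"
  assumes "prob_space \<mu>"
    and "sets \<mu> = Pow (carrier Shuffler)"
    and "finite {g \<in> carrier Shuffler. measure \<mu> {g} \<noteq> 0}"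
    and "recurrent_walk integer_group (distr \<mu> (count_space UNIV) snd)"
  shows "trivial_Poisson_boundary Shuffler \<mu>"
proof -
  interpret P: prob_space \<mu>
    by fact
  interpret W: countable_group_walk Shuffler \<mu>
    using assms group_Shuffler countable_carrier_Shuffler
    by (intro countable_group_walk.intro countable_group_walk_axioms.intro)
  note m = W.measurable_step
  let ?D = "distr \<mu> (count_space UNIV) (\<lambda>x. x)"
  define p where "p = Abs_pmf ?D"
  interpret D: prob_space ?D
    by (rule P.prob_space_distr[OF m])
  have "AE x in ?D. x \<in> carrier Shuffler"
    using AE_space[of \<mu>] by (subst AE_distr_iff[OF m]) (auto simp: W.space_step)
  \<comment> \<open>A measure comes from a pmf only if almost every point is an atom; countability
    of the carrier ensures this.\<close>
  then have "AE x in ?D. measure ?D {x} \<noteq> 0"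
    using countable_carrier_Shuffler by (subst D.AE_support_countable) auto
  then have p: "measure_pmf p = ?D"
    unfolding p_def by (intro Abs_pmf_inverse) (simp add: D.prob_space_axioms)
  have "set_pmf p \<subseteq> {g \<in> carrier Shuffler. measure \<mu> {g} \<noteq> 0}"
  proof
    fix g assume "g \<in> set_pmf p"
    then have "measure \<mu> ({g} \<inter> carrier Shuffler) \<noteq> 0"
      by (simp add: set_pmf.rep_eq p measure_distr[OF m] W.space_step vimage_def)
    moreover from this have "g \<in> carrier Shuffler"
      by (cases "g \<in> carrier Shuffler") auto
    ultimately show "g \<in> {g \<in> carrier Shuffler. measure \<mu> {g} \<noteq> 0}"
      by simp
  qed
  then have fin: "finite (set_pmf p)" and sub: "set_pmf p \<subseteq> carrier Shuffler"
    using assms(3) finite_subset by auto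
  \<comment> \<open>The successor makes \<open>C\<close> positive, as the moment estimates for the
    shuffler walk require.\<close>
  define C where "C = Suc (Max (shuffler_radius ` set_pmf p))"
  have C: "set_pmf p \<subseteq> shuffler_ball C"
  proof
    fix a assume a: "a \<in> set_pmf p"
    then have "shuffler_radius a \<le> C"
      using fin by (simp add: C_def le_SucI)
    then show "a \<in> shuffler_ball C"
      using shuffler_ball_mono in_shuffler_ball_radius a sub by blast
  qed
  define q where "q = map_pmf snd p"
  have "measure_pmf q = distr \<mu> (count_space UNIV) snd"
    unfolding q_def map_pmf_rep_eq p by (subst distr_distr) (auto simp: m o_def)
  then have rec: "recurrent_walk integer_group (measure_pmf q)"
    using assms(4) by simp
  let ?m = "measure_pmf.expectation q real_of_int"
  \<comment> \<open>The support of \<open>q\<close> is finite, so the largest deviation from the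
    mean serves as the step bound.\<close>
  have "?m = 0"
  proof (rule recurrent_imp_mean_zero[OF _ _ rec])
    show "finite (set_pmf q)"
      by (simp add: q_def fin)
    then show "\<bar>real_of_int z - ?m\<bar> \<le> Max ((\<lambda>z. \<bar>real_of_int z - ?m\<bar>) ` set_pmf q)" if "z \<in> set_pmf q" for z
      using that by (intro Max_ge) auto
  qed
  then have mean: "measure_pmf.expectation p (\<lambda>a. real_of_int (snd a)) = 0"
    by (simp add: q_def)
  show ?thesis
    by (rule W.trivial_boundary_of_sublinear_entropy[OF p fin])
      (rule entropy_conv_pow_Shuffler_sublinear[OF fin C _ mean], simp_all add: C_def)
qed

end
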